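(* Let $(Z_n)_{n\ge 0}$ be the $d$-type branching process with immigration in the stationary ergodic random environment $\omega$ described in the context, and assume: (A1) $E_P(\log^+\|I_0\|_1)<\infty$; (A2) $E_P(\log^+\|M_0\|_1)<\infty$; (A3) $\lim_{n\to\infty} n^{-1}E_P(\log\|M_{n-1}\cdots M_1M_0\|_1)<0$. Let $S_n=\sum_{i=0}^{n-1}Z_i$. Then $$\mathbb{P}\Big(\lim_{n\to\infty}\frac{S_n}{n}=\rho\Big)=1,\qquad\text{where } \rho:=\sum_{n=0}^\infty E_P(M_n\cdots M_1M_0I_0)\in(\mathbb{R}_+\cup\{\infty\})^d .$$ (The limit is componentwise, and components of $\rho$ may be $+\infty$.)
   Context: Fix an integer $d\ge 1$. The environment $\omega=(\omega_n)_{n\in\mathbb{Z}}$ is a stationary ergodic sequence of random variables with values in a measurable space $(\mathcal{S},\mathcal{B})$; its law on $(\Omega,\mathcal{F})=(\mathcal{S}^{\mathbb{Z}},\mathcal{B}^{\otimes\mathbb{Z}})$ is $P$, with expectation $E_P$. Let $\mathcal{P}_d$ be the set of probability measures on $\mathbb{Z}_+^d$ ($\mathbb{Z}_+=\mathbb{N}\cup\{0\}$), and let $q,p_1,\dots,p_d:\mathcal{S}\to\mathcal{P}_d$ be measurable. Given $\omega$, under the quenched law $P_\omega$ (expectation $E_\omega$), all of the following random vectors in $\mathbb{Z}_+^d$ are independent: the immigration vectors $X_n=(X_n^{(1)},\dots,X_n^{(d)})$, $n\in\mathbb{Z}_+$, with $X_n$ of law $q_{\omega,n}=q(\omega_{n-1})$;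 and the offspring vectors $L_{n,m}^{(i)}=(L_{n,m}^{(i,1)},\dots,L_{n,m}^{(i,d)})$, $n\in\mathbb{Z}_+$, $m\in\mathbb{N}$, $1\le i\le d$, with $L_{n,m}^{(i)}$ of law $p^{(i)}_{\omega,n}=p_i(\omega_n)$. The process is defined by $Z_0=\mathbf{0}=(0,\dots,0)$ and $$Z_{n+1}=\sum_{i=1}^d\sum_{m=1}^{Z_n^{(i)}+X_n^{(i)}}L_{n,m}^{(i)},\qquad n\ge 0.$$ The joint (annealed) law is $\mathbb{P}=P\otimes P_\omega$, with expectation $\mathbb{E}$. Write $I_n=I_n(\omega)=(E_\omega X_n^{(1)},\dots,E_\omega X_n^{(d)})$ and let $M_n=M_n(\omega)$ be the $d\times d$ matrix whose $i$th column is the vector $(E_\omega L_{n,1}^{(i,1)},\dots,E_\omega L_{n,1}^{(i,d)})$. For $v\in\mathbb{R}^d$, $\|v\|_1=\sum_i|v^{(i)}|$, and for a $d\times d$ matrix $A$, $\|A\|_1$ is the corresponding operator norm. $\log^+x=\max\{0,\log x\}$ and $\log 0=-\infty$. Expectations of vectors are taken componentwise. *)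

theory Defs
  imports "HOL-Probability.Probability"
begin

text \<open>
  The number \<open>d\<close> of types is the cardinality of the finite index type \<open>'d\<close>, so \<open>d \<ge> 1\<close>.
  Elements of \<open>\<int>\<^sub>+\<^sup>d\<close> are vectors of type \<^typ>\<open>nat ^ 'd\<close>, with the discrete \<open>\<sigma>\<close>-algebra.
\<close>

definition shift :: "(int \<Rightarrow> 's) \<Rightarrow> (int \<Rightarrow> 's)" where
  "shift \<omega> = (\<lambda>n. \<omega> (n + 1))"

text \<open>\<open>P\<close> is the law, on \<open>S\<^sup>\<int>\<close> with the product \<open>\<sigma>\<close>-algebra, of a stationary ergodic sequence in \<open>S\<close>.\<close>

locale stationary_ergodic_environment = prob_space P
  for S :: "'s measure" and P :: "(int \<Rightarrow> 's) measure" +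
  assumes sets_P: "sets P = sets (\<Pi>\<^sub>M n\<in>(UNIV :: int set). S)"
    and stationary: "distr P P shift = P"
    and ergodic: "\<And>A. A \<in> sets P \<Longrightarrow> shift -` A \<inter> space P = A \<Longrightarrow> prob A = 0 \<or> prob A = 1"

text \<open>
  The quenched laws are a probability kernel \<open>Q\<close> from \<open>P\<close> to an arbitrary measurable space \<open>N\<close> on
  which the immigration vectors \<open>X n\<close> and the offspring vectors \<open>L n m i\<close> are defined; in
  \<open>L n m i\<close> only \<open>m \<ge> 1\<close> is meaningful.  All these vectors are indexed jointly by
  a sum type in order to state that they are independent as one family.
\<close>

locale branching_process_in_environment = stationary_ergodic_environment S P
  for S :: "'s measure" and P :: "(int \<Rightarrow> 's) measure" +
  fixes q :: "'s \<Rightarrow> (nat ^ 'd) measure"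
    and p :: "'d \<Rightarrow> 's \<Rightarrow> (nat ^ 'd) measure"
    and N :: "'x measure"
    and Q :: "(int \<Rightarrow> 's) \<Rightarrow> 'x measure"
    and X :: "nat \<Rightarrow> 'x \<Rightarrow> nat ^ 'd"
    and L :: "nat \<Rightarrow> nat \<Rightarrow> 'd \<Rightarrow> 'x \<Rightarrow> nat ^ 'd"
  assumes q_measurable: "q \<in> S \<rightarrow>\<^sub>M prob_algebra (count_space UNIV)"
    and p_measurable: "\<And>i. p i \<in> S \<rightarrow>\<^sub>M prob_algebra (count_space UNIV)"
    and Q_measurable: "Q \<in> P \<rightarrow>\<^sub>M prob_algebra N"
    and X_measurable: "\<And>n. X n \<in> N \<rightarrow>\<^sub>M count_space UNIV"
    and L_measurable: "\<And>n m i. m \<ge> 1 \<Longrightarrow> L n m i \<in> N \<rightarrow>\<^sub>M count_space UNIV"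
    and indep: "\<And>\<omega>. \<omega> \<in> space P \<Longrightarrow>
      prob_space.indep_vars (Q \<omega>) (\<lambda>_. count_space UNIV) (case_sum X (\<lambda>(n, m, i). L n m i))
        (UNIV <+> UNIV \<times> {1..} \<times> UNIV)"
    and law_X: "\<And>\<omega> n. \<omega> \<in> space P \<Longrightarrow>
      distr (Q \<omega>) (count_space UNIV) (X n) = q (\<omega> (int n - 1))"
    and law_L: "\<And>\<omega> n m i. \<omega> \<in> space P \<Longrightarrow> m \<ge> 1 \<Longrightarrow>
      distr (Q \<omega>) (count_space UNIV) (L n m i) = p i (\<omega> (int n))"

primrec Z :: "(nat \<Rightarrow> 'x \<Rightarrow> nat ^ 'd) \<Rightarrow> (nat \<Rightarrow> nat \<Rightarrow> 'd::finite \<Rightarrow> 'x \<Rightarrow> nat ^ 'd) \<Rightarrow>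
    nat \<Rightarrow> 'x \<Rightarrow> nat ^ 'd" where
  "Z X L 0 x = 0"
| "Z X L (Suc n) x = (\<Sum>i\<in>UNIV. \<Sum>m = 1..Z X L n x $ i + X n x $ i. L n m i x)"

definition annealed :: "(int \<Rightarrow> 's) measure \<Rightarrow> 'x measure \<Rightarrow> ((int \<Rightarrow> 's) \<Rightarrow> 'x measure) \<Rightarrow>
    ((int \<Rightarrow> 's) \<times> 'x) measure" where
  "annealed P N Q = P \<bind> (\<lambda>\<omega>. distr (Q \<omega>) (P \<Otimes>\<^sub>M N) (Pair \<omega>))"

text \<open>
  Quenched means of nonnegative variables are taken in \<open>[0, \<infinity>]\<close>, since finiteness is
  not assumed a priori.
\<close>

definition imm_mean :: "((int \<Rightarrow> 's) \<Rightarrow> 'x measure) \<Rightarrow> (nat \<Rightarrow> 'x \<Rightarrow> nat ^ 'd) \<Rightarrow>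
    nat \<Rightarrow> (int \<Rightarrow> 's) \<Rightarrow> ennreal ^ 'd" where
  "imm_mean Q X n \<omega> = (\<chi> i. \<integral>\<^sup>+ x. of_nat (X n x $ i) \<partial>Q \<omega>)"

text \<open>The \<open>i\<close>th column (second index) is the mean offspring vector of type \<open>i\<close>.\<close>

definition mean_matrix :: "((int \<Rightarrow> 's) \<Rightarrow> 'x measure) \<Rightarrow> (nat \<Rightarrow> nat \<Rightarrow> 'd \<Rightarrow> 'x \<Rightarrow> nat ^ 'd) \<Rightarrow>
    nat \<Rightarrow> (int \<Rightarrow> 's) \<Rightarrow> ennreal ^ 'd ^ 'd" where
  "mean_matrix Q L n \<omega> = (\<chi> j i. \<integral>\<^sup>+ x. of_nat (L n 1 i x $ j) \<partial>Q \<omega>)"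

text \<open>\<open>mean_prod Q L n \<omega> = M\<^sub>n\<^sub>-\<^sub>1 \<cdots> M\<^sub>1 M\<^sub>0\<close>, the identity matrix for \<open>n = 0\<close>.\<close>

primrec mean_prod :: "((int \<Rightarrow> 's) \<Rightarrow> 'x measure) \<Rightarrow> (nat \<Rightarrow> nat \<Rightarrow> 'd::finite \<Rightarrow> 'x \<Rightarrow> nat ^ 'd) \<Rightarrow>
    nat \<Rightarrow> (int \<Rightarrow> 's) \<Rightarrow> ennreal ^ 'd ^ 'd" where
  "mean_prod Q L 0 \<omega> = mat 1"
| "mean_prod Q L (Suc n) \<omega> = mean_matrix Q L n \<omega> ** mean_prod Q L n \<omega>"

definition norm1 :: "real ^ 'd \<Rightarrow> real" where
  "norm1 v = (\<Sum>i\<in>UNIV. \<bar>v $ i\<bar>)"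

text \<open>The quotient is \<open>0\<close> at \<open>v = 0\<close>, as in the definition of \<^const>\<open>onorm\<close>.\<close>

definition opnorm1 :: "real ^ 'd ^ 'd \<Rightarrow> real" where
  "opnorm1 A = (SUP v. norm1 (A *v v) / norm1 v)"

text \<open>Both norms are extended by \<open>\<infinity>\<close> to vectors and matrices that have an infinite entry.\<close>

definition enorm1 :: "ennreal ^ 'd \<Rightarrow> ennreal" where
  "enorm1 v = (if \<forall>i. v $ i < \<infinity> then ennreal (norm1 (\<chi> i. enn2real (v $ i))) else \<infinity>)"

definition eopnorm1 :: "ennreal ^ 'd ^ 'd \<Rightarrow> ennreal" where
  "eopnorm1 A = (if \<forall>i j. A $ i $ j < \<infinity>
     then ennreal (opnorm1 (\<chi> i j. enn2real (A $ i $ j))) else \<infinity>)"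

definition elog :: "ennreal \<Rightarrow> ereal" where
  "elog x = (if x = 0 then -\<infinity> else if x = \<infinity> then \<infinity> else ereal (ln (enn2real x)))"

definition elog_plus :: "ennreal \<Rightarrow> ereal" where
  "elog_plus x = max 0 (elog x)"

text \<open>
  The expectation of an extended real variable, as the difference of the integrals of its
  positive and negative part (\<^const>\<open>e2ennreal\<close> sends negative numbers to \<open>0\<close>).  It is meaningful
  if one of the two is finite, which is the case wherever it is used below.
\<close>

definition eexpectation :: "'a measure \<Rightarrow> ('a \<Rightarrow> ereal) \<Rightarrow> ereal" where
  "eexpectation P f =
     enn2ereal (\<integral>\<^sup>+ \<omega>. e2ennreal (f \<omega>) \<partial>P) - enn2ereal (\<integral>\<^sup>+ \<omega>. e2ennreal (- f \<omega>) \<partial>P)"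

end

theory Submission
  imports Defs
begin

text \<open>
  At each generation let the families of younger immigrants take the smaller indices.  Then the
  process restarted from \<open>0\<close> at time \<open>1\<close> is the process driven by the shifted data, it is dominated
  by the original one, and the difference is the family of the immigrants of time \<open>0\<close>.  Hence
  \<open>S\<^sub>n\<close> lies between the Birkhoff sums of the progeny of one time's immigrants, truncated after \<open>K\<close>
  generations (for \<open>n - K\<close> summands) and untruncated (for \<open>n\<close> summands).  The environment together
  with all inputs is ergodic under the shift: given \<open>\<omega>\<close>, the section of an invariant event is a tail
  event of independent variables, so it has probability \<open>0\<close> or \<open>1\<close>, and the set of \<open>\<omega>\<close> where it is
  \<open>1\<close> is invariant.  Birkhoff's theorem for nonnegative functions, possibly of infinite mean,
  squeezes \<open>S\<^sub>n / n\<close> between the \<open>K\<close>th partial sum of \<open>\<rho>\<close> and \<open>\<rho>\<close> itself.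
\<close>

subsection \<open>Birkhoff's ergodic theorem\<close>

text \<open>The maximum of the ergodic sums of \<open>f\<close> of lengths 1 to
  \<open>n + 1\<close>, computed by splitting off the first summand.\<close>

primrec birkhoff_max :: "('a \<Rightarrow> 'a) \<Rightarrow> ('a \<Rightarrow> real) \<Rightarrow> nat \<Rightarrow> 'a \<Rightarrow> real" where
  "birkhoff_max T f 0 x = f x"
| "birkhoff_max T f (Suc n) x = f x + max 0 (birkhoff_max T f n (T x))"

lemma birkhoff_max_mono: "birkhoff_max T f n x \<le> birkhoff_max T f (Suc n) x"
proof (induction n arbitrary: x)
  case (Suc n)
  show ?case using Suc[of "T x"] by (simp only: birkhoff_max.simps(2)[of T f _ x])
qed simp

lemma birkhoff_max_le: "m \<le> n \<Longrightarrow> birkhoff_max T f m x \<le> birkhoff_max T f n x"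
  by (rule lift_Suc_mono_le[where f = "\<lambda>n. birkhoff_max T f n x", OF birkhoff_max_mono])

lemma birkhoff_sum_Suc: "(\<Sum>k<Suc n. f ((T ^^ k) x)) = f x + (\<Sum>k<n. f ((T ^^ k) (T x)))"
  for f :: "'a \<Rightarrow> 'b::comm_monoid_add"
  by (subst sum.lessThan_Suc_shift) (simp add: funpow_swap1)

lemma birkhoff_sum_le_max: "(\<Sum>k<Suc n. f ((T ^^ k) x)) \<le> birkhoff_max T f n x"
proof (induction n arbitrary: x)
  case (Suc n)
  show ?case
    using Suc[of "T x"] by (subst birkhoff_sum_Suc) simp
qed simp

locale ergodic_system = prob_space M for M :: "'a measure" +
  fixes T :: "'a \<Rightarrow> 'a"
  assumes T_measurable [measurable]: "T \<in> M \<rightarrow>\<^sub>M M"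
    and T_preserving: "distr M M T = M"
    and T_ergodic: "\<And>A. A \<in> sets M \<Longrightarrow> T -` A \<inter> space M = A \<Longrightarrow> prob A = 0 \<or> prob A = 1"
begin

lemma AE_T: "AE x in M. R x \<Longrightarrow> AE x in M. R (T x)"
  by (rule AE_distrD[OF T_measurable]) (simp only: T_preserving)

lemma AE_funpow: "AE x in M. R x \<Longrightarrow> AE x in M. R ((T ^^ n) x)"
proof (induction n)
  case (Suc n)
  then show ?case using AE_T[of "\<lambda>x. R ((T ^^ n) x)"] by (simp add: funpow_swap1)
qed simp

lemma integrable_T: "integrable M f \<Longrightarrow> integrable M (\<lambda>x. f (T x))" for f :: "'a \<Rightarrow> real"
  by (rule integrable_distr[OF T_measurable]) (simp add: T_preserving)

lemma integral_T: "integrable M f \<Longrightarrow> (\<integral>x. f (T x) \<partial>M) = (\<integral>x. f x \<partial>M)" for f :: "'a \<Rightarrow> real"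
  using integral_distr[OF T_measurable, of f] unfolding T_preserving
  by (metis borel_measurable_integrable)

lemma integrable_birkhoff_max:
  assumes "integrable M f"
  shows "integrable M (birkhoff_max T f n)"
proof (induction n)
  case 0
  then show ?case using assms by simp
next
  case (Suc n)
  then show ?case using assms
    by (auto intro!: Bochner_Integration.integrable_add integrable_max integrable_T)
qed

text \<open>The maximal ergodic argument, by contradiction. The set where the maxima are unbounded
  is invariant, so it is null or full. If it were full,
  \<open>birkhoff_max T f (Suc n) x - birkhoff_max T f n (T x)\<close> would tend to
  \<open>f x\<close> almost everywhere, while its integral is nonnegative because \<open>T\<close>
  preserves the measure and the maxima grow with \<open>n\<close>. The mean of \<open>f\<close>
  would then be nonnegative.\<close>

lemma birkhoff_max_bounded:
  assumes f: "integrable M f" and neg: "expectation f < 0"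
  shows "AE x in M. \<exists>B::nat. \<forall>n. birkhoff_max T f n x \<le> real B"
proof -
  note int = integrable_birkhoff_max[OF f]
  note [measurable] = borel_measurable_integrable[OF f] borel_measurable_integrable[OF int]
  define A where "A = {x\<in>space M. \<forall>B::nat. \<exists>n. birkhoff_max T f n x > real B}"
  have A [measurable]: "A \<in> sets M"
    unfolding A_def by measurable
  have inv: "T -` A \<inter> space M = A"
  proof -
    have "(\<forall>B::nat. \<exists>n. birkhoff_max T f n (T x) > real B) \<longleftrightarrow>
      (\<forall>B::nat. \<exists>n. birkhoff_max T f n x > real B)" (is "?l \<longleftrightarrow> ?r") if "x \<in> space M" for x
    proof
      assume l: ?l
      show ?r
      proof
        fix B :: nat
        \<comment> \<open>The margin added to \<open>B\<close> absorbs a negative value of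
          \<open>f x\<close>.\<close>
        obtain n where "birkhoff_max T f n (T x) > real (B + nat \<lceil>- f x\<rceil>)" using l by blast
        moreover have "real (nat \<lceil>- f x\<rceil>) \<ge> - f x" by linarith
        ultimately have "birkhoff_max T f (Suc n) x > real B" by simp
        then show "\<exists>n. birkhoff_max T f n x > real B" by blast
      qed
    next
      assume r: ?r
      show ?l
      proof
        fix B :: nat
        obtain b :: nat where b: "f x \<le> real b" using real_arch_simple by blast
        obtain n where "birkhoff_max T f n x > real (B + b)" using r by blast
        \<comment> \<open>The case \<open>n = 0\<close> contradicts the choice of \<open>b\<close>.
          Otherwise the maximum of 0 and the value at \<open>T x\<close> exceeds \<open>B\<close>,
          so 0 is not the larger of the two.\<close>
        then have "birkhoff_max T f (n - 1) (T x) > real B"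
          using b by (cases n) (auto simp: max_def split: if_splits)
        then show "\<exists>n. birkhoff_max T f n (T x) > real B" by blast
      qed
    qed
    then show ?thesis
      using measurable_space[OF T_measurable] by (auto simp: A_def)
  qed
  have "prob A \<noteq> 1"
  proof
    assume "prob A = 1"
    then have AE_A: "AE x in M. x \<in> A" by (subst (asm) prob_eq_1) auto
    define d where "d n x = birkhoff_max T f (Suc n) x - birkhoff_max T f n (T x)" for n x
    \<comment> \<open>The correction to \<open>f x\<close> vanishes once the maximum at
      \<open>T x\<close> is positive, which on \<open>A\<close> is the case for all large
      \<open>n\<close>.\<close>
    have d_eq: "d n x = f x + max 0 (- birkhoff_max T f n (T x))" for n x
      by (simp add: d_def)
    have d_nonneg: "0 \<le> integral\<^sup>L M (d n)" for n
    proof -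
      have "integral\<^sup>L M (d n) =
          integral\<^sup>L M (birkhoff_max T f (Suc n)) - (\<integral>x. birkhoff_max T f n (T x) \<partial>M)"
        unfolding d_def by (rule Bochner_Integration.integral_diff[OF int integrable_T[OF int]])
      moreover have "(\<integral>x. birkhoff_max T f n (T x) \<partial>M) = integral\<^sup>L M (birkhoff_max T f n)"
        by (rule integral_T[OF int])
      moreover have "integral\<^sup>L M (birkhoff_max T f n) \<le> integral\<^sup>L M (birkhoff_max T f (Suc n))"
        by (rule integral_mono[OF int int birkhoff_max_mono])
      ultimately show ?thesis by linarith
    qed
    have "(\<lambda>n. integral\<^sup>L M (d n)) \<longlonglongrightarrow> integral\<^sup>L M f"
    proof (rule integral_dominated_convergence)
      \<comment> \<open>The maximum at \<open>T x\<close> is at least its value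
        \<open>f (T x)\<close> for index 0, so the correction in \<open>d_eq\<close> is at most the
        absolute value of \<open>f (T x)\<close>.\<close>
      show "integrable M (\<lambda>x. \<bar>f x\<bar> + \<bar>f (T x)\<bar>)"
        using f integrable_T[OF f] by auto
      show "AE x in M. (\<lambda>n. d n x) \<longlonglongrightarrow> f x"
        using AE_A
      proof eventually_elim
        fix x assume "x \<in> A"
        then have "x \<in> T -` A" using inv by auto
        then have "\<exists>n. birkhoff_max T f n (T x) > real 0" unfolding A_def by blast
        then obtain n0 where n0: "birkhoff_max T f n0 (T x) > 0" by auto
        have "d n x = f x" if "n \<ge> n0" for n
        proof -
          have "birkhoff_max T f n0 (T x) \<le> birkhoff_max T f n (T x)"
            by (rule birkhoff_max_le[OF that])
          then show ?thesis using n0 by (simp add: d_eq)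
        qed
        then have "\<forall>\<^sub>F n in sequentially. d n x = f x"
          by (auto simp: eventually_sequentially)
        then show "(\<lambda>n. d n x) \<longlonglongrightarrow> f x" by (rule tendsto_eventually)
      qed
      show "AE x in M. norm (d n x) \<le> \<bar>f x\<bar> + \<bar>f (T x)\<bar>" for n
      proof (rule AE_I2)
        fix x
        have "birkhoff_max T f 0 (T x) \<le> birkhoff_max T f n (T x)"
          by (rule birkhoff_max_le) simp
        then show "norm (d n x) \<le> \<bar>f x\<bar> + \<bar>f (T x)\<bar>" by (simp add: d_eq)
      qed
    qed (auto simp: d_def[abs_def])
    then have "0 \<le> integral\<^sup>L M f"
      by (rule LIMSEQ_le_const) (use d_nonneg in auto)
    then show False using neg by simp
  qed
  then have "prob A = 0" using T_ergodic[OF A inv] by simp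
  then have "AE x in M. x \<notin> A"
    using A by (simp add: prob_eq_0)
  then show ?thesis
    using AE_space by eventually_elim (auto simp: A_def not_less)
qed

text \<open>Subtracting a level \<open>c'\<close> strictly between the mean and \<open>c\<close>
  makes the mean negative. Bounded maxima then keep the sums of length \<open>n\<close> below
  \<open>B + n * c'\<close>, and \<open>B\<close> is eventually absorbed by
  \<open>n * (c - c')\<close>.\<close>

lemma birkhoff_upper:
  assumes f: "integrable M f" and c: "expectation f < c"
  shows "AE x in M. \<forall>\<^sub>F n in sequentially. (\<Sum>k<n. f ((T ^^ k) x)) / real n < c"
proof -
  obtain c' where c': "expectation f < c'" "c' < c" using dense[OF c] by blast
  define g where "g x = f x - c'" for x
  have g: "integrable M g" "expectation g < 0"
    unfolding g_def using f c' by (auto simp: prob_space)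
  show ?thesis
    using birkhoff_max_bounded[OF g]
  proof eventually_elim
    fix x assume "\<exists>B::nat. \<forall>n. birkhoff_max T g n x \<le> real B"
    then obtain B :: nat where B: "\<And>n. birkhoff_max T g n x \<le> real B" by blast
    \<comment> \<open>The sum of length \<open>n\<close> is one of those compared by
      \<open>birkhoff_max\<close> at index \<open>n - 1\<close>.\<close>
    have le: "(\<Sum>k<n. f ((T ^^ k) x)) \<le> real B + real n * c'" if "n > 0" for n
      using birkhoff_sum_le_max[of g T x "n - 1"] B[of "n - 1"] that
      by (simp add: g_def sum_subtractf)
    obtain n0 where n0: "real n0 > real B / (c - c')" using reals_Archimedean2 by blast
    have "(\<Sum>k<n. f ((T ^^ k) x)) / real n < c" if "n \<ge> Suc n0" for n
    proof -
      have "real B / (c - c') < real n" using n0 that by linarith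
      then have "real B < real n * (c - c')" using c' by (simp add: divide_less_eq)
      then show ?thesis using le[of n] that by (simp add: divide_less_eq algebra_simps)
    qed
    then show "\<forall>\<^sub>F n in sequentially. (\<Sum>k<n. f ((T ^^ k) x)) / real n < c"
      by (rule eventually_sequentiallyI)
  qed
qed

text \<open>The lower bound is the upper bound for \<open>- f\<close>. Margins
  \<open>1 / (m + 1)\<close> leave only countably many exceptional sets.\<close>

theorem birkhoff:
  assumes f: "integrable M f"
  shows "AE x in M. (\<lambda>n. (\<Sum>k<n. f ((T ^^ k) x)) / real n) \<longlonglongrightarrow> expectation f"
proof -
  have "AE x in M. \<forall>m. \<forall>\<^sub>F n in sequentially.
      (\<Sum>k<n. f ((T ^^ k) x)) / real n < expectation f + 1 / real (Suc m)"
    unfolding AE_all_countable by (intro allI birkhoff_upper f) simp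
  moreover have "AE x in M. \<forall>m. \<forall>\<^sub>F n in sequentially.
      (\<Sum>k<n. - f ((T ^^ k) x)) / real n < - expectation f + 1 / real (Suc m)"
    unfolding AE_all_countable by (intro allI birkhoff_upper) (use f in simp_all)
  ultimately show ?thesis
  proof eventually_elim
    fix x
    assume up: "\<forall>m. \<forall>\<^sub>F n in sequentially.
        (\<Sum>k<n. f ((T ^^ k) x)) / real n < expectation f + 1 / real (Suc m)"
      and lo: "\<forall>m. \<forall>\<^sub>F n in sequentially.
        (\<Sum>k<n. - f ((T ^^ k) x)) / real n < - expectation f + 1 / real (Suc m)"
    show "(\<lambda>n. (\<Sum>k<n. f ((T ^^ k) x)) / real n) \<longlonglongrightarrow> expectation f"
    proof (rule tendstoI)
      fix e :: real assume "e > 0"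
      then obtain m where m: "1 / real (Suc m) < e" using nat_approx_posE by blast
      show "\<forall>\<^sub>F n in sequentially. dist ((\<Sum>k<n. f ((T ^^ k) x)) / real n) (expectation f) < e"
        using up[rule_format, of m] lo[rule_format, of m]
      proof eventually_elim
        case (elim n)
        then show ?case using m by (simp add: dist_real_def sum_negf abs_less_iff)
      qed
    qed
  qed
qed

text \<open>With a finite mean, \<open>f\<close> is almost everywhere finite along whole orbits and
  the real theorem applies. With an infinite mean, the truncations \<open>min (f x) B\<close> have
  finite means that tend to infinity by monotone convergence, and their averages bound those of
  \<open>f\<close> from below.\<close>

theorem birkhoff_ennreal:
  fixes f :: "'a \<Rightarrow> ennreal"
  assumes f [measurable]: "f \<in> borel_measurable M"
  shows "AE x in M. (\<lambda>n. (\<Sum>k<n. f ((T ^^ k) x)) / of_nat n) \<longlonglongrightarrow> (\<integral>\<^sup>+ x. f x \<partial>M)"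
proof -
  have *: "AE x in M. (\<lambda>n. (\<Sum>k<n. f ((T ^^ k) x)) / of_nat n) \<longlonglongrightarrow> (\<integral>\<^sup>+ x. f x \<partial>M)"
    if f [measurable]: "f \<in> borel_measurable M" and fin: "(\<integral>\<^sup>+ x. f x \<partial>M) < \<infinity>" for f
  proof -
    define g where "g x = enn2real (f x)" for x
    have g: "integrable M g"
      unfolding g_def using fin
      by (intro integrableI_nonneg) (auto simp: ennreal_enn2real_if elim!: le_less_trans[rotated] intro!: nn_integral_mono)
    have ae: "AE x in M. f x = ennreal (g x)"
      using nn_integral_PInf_AE[OF f] fin
      by (auto simp: g_def less_top)
    have "(\<integral>\<^sup>+ x. f x \<partial>M) = ennreal (expectation g)"
      using ae by (subst nn_integral_eq_integral[symmetric, OF g])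
         (auto simp: g_def intro!: nn_integral_cong_AE)
    moreover have "AE x in M. \<forall>k. f ((T ^^ k) x) = ennreal (g ((T ^^ k) x))"
      unfolding AE_all_countable by (intro allI AE_funpow ae)
    ultimately show ?thesis
      using birkhoff[OF g]
    proof (elim AE_mp, intro AE_I2 impI)
      fix x
      assume eq: "(\<integral>\<^sup>+ x. f x \<partial>M) = ennreal (expectation g)"
        and fg: "\<forall>k. f ((T ^^ k) x) = ennreal (g ((T ^^ k) x))"
        and lim: "(\<lambda>n. (\<Sum>k<n. g ((T ^^ k) x)) / real n) \<longlonglongrightarrow> expectation g"
      have "(\<lambda>n. ennreal ((\<Sum>k<n. g ((T ^^ k) x)) / real n)) \<longlonglongrightarrow> (\<integral>\<^sup>+ x. f x \<partial>M)"
        unfolding eq by (intro tendsto_ennrealI lim)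
      moreover have "\<forall>\<^sub>F n in sequentially. ennreal ((\<Sum>k<n. g ((T ^^ k) x)) / real n) =
          (\<Sum>k<n. f ((T ^^ k) x)) / of_nat n"
        using eventually_gt_at_top[of 0]
      proof eventually_elim
        fix n :: nat assume "n > 0"
        moreover have "(\<Sum>k<n. f ((T ^^ k) x)) = ennreal (\<Sum>k<n. g ((T ^^ k) x))"
          using fg by (subst sum_ennreal[symmetric]) (auto simp: g_def)
        ultimately show "ennreal ((\<Sum>k<n. g ((T ^^ k) x)) / real n) = (\<Sum>k<n. f ((T ^^ k) x)) / of_nat n"
          by (simp add: divide_ennreal sum_nonneg g_def flip: ennreal_of_nat_eq_real_of_nat)
             (simp add: divide_ennreal sum_nonneg ennreal_of_nat_eq_real_of_nat)
      qed
      ultimately show "(\<lambda>n. (\<Sum>k<n. f ((T ^^ k) x)) / of_nat n) \<longlonglongrightarrow> (\<integral>\<^sup>+ x. f x \<partial>M)"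
        by (rule Lim_transform_eventually)
    qed
  qed
  show ?thesis
  proof (cases "(\<integral>\<^sup>+ x. f x \<partial>M) < \<infinity>")
    case True
    then show ?thesis by (intro * f)
  next
    case False
    then have inf: "(\<integral>\<^sup>+ x. f x \<partial>M) = \<infinity>" using top.not_eq_extremum by force
    define h where "h B x = min (f x) (of_nat B)" for B :: nat and x
    have [measurable]: "h B \<in> borel_measurable M" for B by (simp add: h_def[abs_def])
    have h_fin: "(\<integral>\<^sup>+ x. h B x \<partial>M) < \<infinity>" for B
    proof -
      have "(\<integral>\<^sup>+ x. h B x \<partial>M) \<le> (\<integral>\<^sup>+ x. of_nat B \<partial>M)"
        by (intro nn_integral_mono) (simp add: h_def)
      then show ?thesis by (simp add: emeasure_space_1 of_nat_less_top le_less_trans)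
    qed
    have sup: "(SUP B. \<integral>\<^sup>+ x. h B x \<partial>M) = \<infinity>"
    proof -
      have "(SUP B. h B x) = f x" for x
      proof (rule antisym)
        show "(SUP B. h B x) \<le> f x" by (rule SUP_least) (simp add: h_def)
        have "f x = min (f x) (SUP B::nat. of_nat B)" by (simp add: ennreal_SUP_of_nat_eq_top)
        also have "\<dots> \<le> (SUP B. h B x)" by (simp add: h_def inf_SUP flip: inf_min)
        finally show "f x \<le> (SUP B. h B x)" .
      qed
      moreover have "incseq h"
        by (auto simp: incseq_def h_def le_fun_def intro: min.coboundedI2)
      ultimately have "(\<integral>\<^sup>+ x. f x \<partial>M) = (SUP B. \<integral>\<^sup>+ x. h B x \<partial>M)"
        using nn_integral_monotone_convergence_SUP[of h M] by simp
      then show ?thesis using inf by simp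
    qed
    have "AE x in M. \<forall>B. (\<lambda>n. (\<Sum>k<n. h B ((T ^^ k) x)) / of_nat n) \<longlonglongrightarrow> (\<integral>\<^sup>+ x. h B x \<partial>M)"
      unfolding AE_all_countable by (intro allI * h_fin) measurable
    then show ?thesis
    proof eventually_elim
      fix x
      assume lim: "\<forall>B. (\<lambda>n. (\<Sum>k<n. h B ((T ^^ k) x)) / of_nat n) \<longlonglongrightarrow> (\<integral>\<^sup>+ x. h B x \<partial>M)"
      show "(\<lambda>n. (\<Sum>k<n. f ((T ^^ k) x)) / of_nat n) \<longlonglongrightarrow> (\<integral>\<^sup>+ x. f x \<partial>M)"
        unfolding inf
      proof (rule order_tendstoI)
        fix a :: ennreal assume "a < \<infinity>"
        then obtain B where B: "a < (\<integral>\<^sup>+ x. h B x \<partial>M)"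
          using sup less_SUP_iff by metis
        show "\<forall>\<^sub>F n in sequentially. a < (\<Sum>k<n. f ((T ^^ k) x)) / of_nat n"
          using order_tendstoD(1)[OF lim[rule_format, of B] B]
        proof eventually_elim
          case (elim n)
          also have "(\<Sum>k<n. h B ((T ^^ k) x)) / of_nat n \<le> (\<Sum>k<n. f ((T ^^ k) x)) / of_nat n"
            by (intro divide_right_mono_ennreal sum_mono) (simp add: h_def)
          finally show ?case .
        qed
      qed simp
    qed
  qed
qed

end

subsection \<open>Decomposition into families\<close>

lemma Z_Suc_nth:
  "Z X L (Suc n) x $ j = (\<Sum>i\<in>UNIV. \<Sum>m<Z X L n x $ i + X n x $ i. L n (Suc m) i x $ j)"
proof -
  have "(\<Sum>m = 1..k. L n m i x $ j) = (\<Sum>m<k. L n (Suc m) i x $ j)" for k i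
    using sum.shift_bounds_cl_Suc_ivl[of "\<lambda>m. L n m i x $ j" 0 "k - 1"]
    by (cases k) (simp_all add: lessThan_Suc_atMost atLeast0AtMost)
  then show ?thesis by (simp add: sum_component)
qed

lemma Z_cong:
  assumes "\<And>k. k < n \<Longrightarrow> X k x = X' k x'" "\<And>k m i. k < n \<Longrightarrow> m \<ge> 1 \<Longrightarrow> L k m i x = L' k m i x'"
  shows "Z X L n x = Z X' L' n x'"
  using assms by (induction n) simp_all

text \<open>
  A realization \<open>y\<close> of all immigration and offspring vectors: the coordinate \<open>(n, None)\<close> is \<open>X\<^sub>n\<close>
  and the coordinate \<open>(n, Some (m, i))\<close> is the offspring vector of index \<open>m + 1\<close>.
\<close>

type_synonym 'd path = "nat \<times> (nat \<times> 'd) option \<Rightarrow> nat ^ 'd"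

definition ZP :: "nat \<Rightarrow> 'd::finite path \<Rightarrow> nat ^ 'd" where
  "ZP = Z (\<lambda>n y. y (n, None)) (\<lambda>n m i y. y (n, Some (m - 1, i)))"

definition path_shift :: "'d path \<Rightarrow> 'd path" where
  "path_shift y = (\<lambda>j. y (Suc (fst j), snd j))"

lemma path_shift_simp [simp]: "path_shift y (n, c) = y (Suc n, c)"
  by (simp add: path_shift_def)

lemma path_shift_funpow [simp]: "(path_shift ^^ n) y (k, c) = y (n + k, c)"
  by (induction n arbitrary: k) simp_all

lemma ZP_0 [simp]: "ZP 0 y = 0"
  by (simp add: ZP_def)

lemma ZP_Suc_nth:
  "ZP (Suc n) y $ j = (\<Sum>i\<in>UNIV. \<Sum>m<ZP n y $ i + y (n, None) $ i. y (n, Some (m, i)) $ j)"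
  unfolding ZP_def by (subst Z_Suc_nth) simp

lemma ZP_cong:
  "(\<And>k c. k < n \<Longrightarrow> y (k, c) = y' (k, c)) \<Longrightarrow> ZP n y = ZP n y'"
  unfolding ZP_def by (rule Z_cong) auto

text \<open>From time 1 on both processes read the same immigrants and offspring vectors, and the
  restarted one starts from 0. A smaller population reads an initial segment of the indices read by
  a larger one, so the order persists.\<close>

lemma ZP_shift_le: "ZP n (path_shift y) $ j \<le> ZP (Suc n) y $ j"
proof (induction n arbitrary: j)
  case (Suc n)
  show ?case
    unfolding ZP_Suc_nth[of n] ZP_Suc_nth[of "Suc n"] path_shift_simp
    by (intro sum_mono sum_mono2) (use Suc[unfolded ZP_Suc_nth] in auto)
qed simp

text \<open>
  \<open>family n y\<close> is generation \<open>n\<close> of the family founded by the immigrants of time \<open>0\<close>, and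
  \<open>younger n y\<close> counts the other individuals present at time \<open>n\<close>, including the immigrants.
  Numbering the younger individuals first makes all families look alike up to a shift.
\<close>

fun family :: "nat \<Rightarrow> 'd::finite path \<Rightarrow> nat ^ 'd" where
  "family 0 y = y (0, None)"
| "family (Suc n) y = (\<chi> i. ZP (Suc n) y $ i - ZP n (path_shift y) $ i)"

fun younger :: "nat \<Rightarrow> 'd::finite path \<Rightarrow> nat ^ 'd" where
  "younger 0 y = 0"
| "younger (Suc n) y = ZP n (path_shift y) + y (Suc n, None)"

text \<open>By \<open>ZP_shift_le\<close> the subtraction of natural numbers in
  \<open>family\<close> is never cut off at 0.\<close>

lemma ZP_Suc_eq_family: "ZP (Suc n) y $ j = family (Suc n) y $ j + ZP n (path_shift y) $ j"
  using ZP_shift_le[of n y j] by simp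

lemma younger_add_family: "younger n y $ i + family n y $ i = ZP n y $ i + y (n, None) $ i"
proof (cases n)
  case (Suc k)
  then show ?thesis using ZP_Suc_eq_family[of k y i] by simp
qed simp

text \<open>The younger individuals occupy the initial indices, so their offspring vectors are
  exactly those read by the restarted process. For \<open>n = 0\<close> both sides vanish.\<close>

lemma ZP_shift_eq_younger:
  "ZP n (path_shift y) $ j = (\<Sum>i\<in>UNIV. \<Sum>m<younger n y $ i. y (n, Some (m, i)) $ j)"
  by (cases n) (simp_all add: ZP_Suc_nth)

text \<open>Removing the initial segment of the younger individuals from all indices in use leaves
  one consecutive block. This is the branching recursion of a single family.\<close>

lemma family_Suc_nth:
  "family (Suc n) y $ j =
    (\<Sum>i\<in>UNIV. \<Sum>m = younger n y $ i..<younger n y $ i + family n y $ i. y (n, Some (m, i)) $ j)"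
proof -
  have "ZP (Suc n) y $ j = (\<Sum>i\<in>UNIV. \<Sum>m<younger n y $ i + family n y $ i. y (n, Some (m, i)) $ j)"
    by (simp add: ZP_Suc_nth younger_add_family)
  also have "\<dots> = (\<Sum>i\<in>UNIV. (\<Sum>m<younger n y $ i. y (n, Some (m, i)) $ j) +
      (\<Sum>m = younger n y $ i..<younger n y $ i + family n y $ i. y (n, Some (m, i)) $ j))"
    by (intro sum.cong refl) (simp add: lessThan_atLeast0 sum.atLeastLessThan_concat)
  finally show ?thesis
    using ZP_Suc_eq_family[of n y j] by (simp add: sum.distrib ZP_shift_eq_younger del: family.simps)
qed

text \<open>This is the adaptedness used for independence later: the position and the size of the
  family at time \<open>n\<close> do not depend on the offspring vectors of generation
  \<open>n\<close>.\<close>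

lemma family_cong:
  assumes "\<And>k c. k < n \<Longrightarrow> y (k, c) = y' (k, c)" "y (n, None) = y' (n, None)"
  shows "family n y = family n y'" "younger n y = younger n y'"
proof -
  have 1: "ZP n y = ZP n y'" by (rule ZP_cong) (rule assms(1))
  have 2: "ZP k (path_shift y) = ZP k (path_shift y')" if "n = Suc k" for k
    by (rule ZP_cong) (use assms that in simp)
  show "family n y = family n y'" "younger n y = younger n y'"
    using 1 2 assms by (cases n; simp)+
qed

text \<open>Generations 1 to \<open>K\<close> only: immigrants enter \<open>Z\<close> through their
  offspring and are not counted themselves.\<close>

definition progeny :: "nat \<Rightarrow> 'd::finite path \<Rightarrow> 'd \<Rightarrow> nat" where
  "progeny K y i = (\<Sum>n<K. family (Suc n) y $ i)"

text \<open>Splitting off the family founded at time 0 leaves the same sum for the shifted path.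
  Iterated, this sorts all individuals by the time at which their ancestor immigrated.\<close>

lemma sum_ZP_Suc:
  "(\<Sum>k<Suc n. ZP k y $ i) = progeny n y i + (\<Sum>k<n. ZP k (path_shift y) $ i)"
  by (subst sum.lessThan_Suc_shift)
     (simp add: progeny_def ZP_Suc_eq_family sum.distrib del: family.simps)

lemma progeny_mono: "m \<le> n \<Longrightarrow> progeny m y i \<le> progeny n y i"
  unfolding progeny_def by (intro sum_mono2) auto

text \<open>Each founding time before \<open>n\<close> contributes at most its total progeny over
  all generations.\<close>

lemma sum_ZP_le:
  "of_nat (\<Sum>k<n. ZP k y $ i) \<le> (\<Sum>k<n. SUP K. of_nat (progeny K ((path_shift ^^ k) y) i) :: ennreal)"
proof (induction n arbitrary: y)
  case (Suc n)
  have "of_nat (\<Sum>k<Suc n. ZP k y $ i) =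
      of_nat (progeny n y i) + (of_nat (\<Sum>k<n. ZP k (path_shift y) $ i) :: ennreal)"
    by (simp only: sum_ZP_Suc of_nat_add)
  also have "\<dots> \<le> (SUP K. of_nat (progeny K y i)) +
      (\<Sum>k<n. SUP K. of_nat (progeny K ((path_shift ^^ k) (path_shift y)) i))"
    by (intro add_mono Suc.IH SUP_upper) simp
  also have "\<dots> = (\<Sum>k<Suc n. SUP K. of_nat (progeny K ((path_shift ^^ k) y) i))"
    by (rule birkhoff_sum_Suc[where f = "\<lambda>y. SUP K. of_nat (progeny K y i)", symmetric])
  finally show ?case .
qed simp

text \<open>The first \<open>K\<close> generations of a family founded before time \<open>n\<close>
  all live before time \<open>n + K\<close>.\<close>

lemma sum_ZP_ge:
  "(\<Sum>k<n. progeny K ((path_shift ^^ k) y) i) \<le> (\<Sum>k<n + K. ZP k y $ i)"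
proof (induction n arbitrary: y)
  case (Suc n)
  have "(\<Sum>k<Suc n. progeny K ((path_shift ^^ k) y) i) =
      progeny K y i + (\<Sum>k<n. progeny K ((path_shift ^^ k) (path_shift y)) i)"
    by (rule birkhoff_sum_Suc[where f = "\<lambda>y. progeny K y i"])
  also have "\<dots> \<le> progeny (n + K) y i + (\<Sum>k<n + K. ZP k (path_shift y) $ i)"
    by (intro add_mono Suc.IH progeny_mono) simp
  also have "\<dots> = (\<Sum>k<Suc n + K. ZP k y $ i)"
    by (simp only: sum_ZP_Suc add_Suc)
  finally show ?case .
qed simp

section \<open>Measurability of the process and its families on path space\<close>

lemma measurable_sum_count_space:
  fixes f :: "'i \<Rightarrow> 'a \<Rightarrow> 'b::{countable, comm_monoid_add}"
  assumes "\<And>i. i \<in> A \<Longrightarrow> f i \<in> M \<rightarrow>\<^sub>M count_space UNIV"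
  shows "(\<lambda>x. \<Sum>i\<in>A. f i x) \<in> M \<rightarrow>\<^sub>M count_space UNIV"
  using assms
proof (induction A rule: infinite_finite_induct)
  case (insert a A)
  have "(\<lambda>x. f a x + (\<Sum>i\<in>A. f i x)) \<in> M \<rightarrow>\<^sub>M count_space UNIV"
  proof (rule measurable_compose_countable[where f = "\<lambda>z x. z + (\<Sum>i\<in>A. f i x)"])
    show "(\<lambda>x. z + (\<Sum>i\<in>A. f i x)) \<in> M \<rightarrow>\<^sub>M count_space UNIV" for z
      by (rule measurable_compose[OF insert.IH]) (use insert.prems in auto)
  qed (use insert.prems in auto)
  then show ?case using insert.hyps by simp
qed simp_all

text \<open>The summation ranges are random but take countably many values, so they can be frozen
  one value at a time.\<close>

lemma measurable_Z:
  fixes X :: "nat \<Rightarrow> 'x \<Rightarrow> nat ^ 'd"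
  assumes X: "\<And>n. X n \<in> M \<rightarrow>\<^sub>M count_space UNIV"
    and L: "\<And>n m i. m \<ge> 1 \<Longrightarrow> L n m i \<in> M \<rightarrow>\<^sub>M count_space UNIV"
  shows "Z X L n \<in> M \<rightarrow>\<^sub>M count_space UNIV"
proof (induction n)
  case (Suc n)
  have "(\<lambda>x. \<Sum>i\<in>UNIV. \<Sum>m = 1..z $ i + z' $ i. L n m i x) \<in> M \<rightarrow>\<^sub>M count_space UNIV" for z z'
    by (intro measurable_sum_count_space L) auto
  then have "(\<lambda>x. \<Sum>i\<in>UNIV. \<Sum>m = 1..z $ i + X n x $ i. L n m i x) \<in> M \<rightarrow>\<^sub>M count_space UNIV" for z
    by (rule measurable_compose_countable[OF _ X[of n]])
  then have "(\<lambda>x. \<Sum>i\<in>UNIV. \<Sum>m = 1..Z X L n x $ i + X n x $ i. L n m i x) \<in> M \<rightarrow>\<^sub>M count_space UNIV"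
    by (rule measurable_compose_countable[OF _ Suc])
  then show ?case by (simp only: Z.simps(2)[abs_def])
qed simp

abbreviation path_space :: "'d::finite path measure" where
  "path_space \<equiv> \<Pi>\<^sub>M j\<in>UNIV. count_space UNIV"

lemma space_path_space [simp]: "space path_space = UNIV"
  by (simp add: space_PiM PiE_UNIV_domain)

lemma measurable_to_path_space:
  assumes "\<And>j. (\<lambda>x. f x j) \<in> M \<rightarrow>\<^sub>M count_space UNIV"
  shows "f \<in> M \<rightarrow>\<^sub>M path_space"
proof -
  have "(\<lambda>x j. f x j) \<in> M \<rightarrow>\<^sub>M path_space"
    by (rule measurable_PiM_single') (use assms in auto)
  then show ?thesis .
qed

lemma measurable_path_component: "(\<lambda>y. y j) \<in> path_space \<rightarrow>\<^sub>M count_space UNIV"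
  by (rule measurable_component_singleton) simp

lemma measurable_path_shift [measurable]: "path_shift \<in> path_space \<rightarrow>\<^sub>M path_space"
  by (rule measurable_to_path_space) (simp add: path_shift_def measurable_path_component)

lemma measurable_ZP: "ZP n \<in> path_space \<rightarrow>\<^sub>M count_space UNIV"
  unfolding ZP_def by (intro measurable_Z measurable_path_component)

lemma measurable_family: "family n \<in> path_space \<rightarrow>\<^sub>M count_space UNIV"
proof (cases n)
  case 0
  then show ?thesis by (simp add: family.simps(1)[abs_def] measurable_path_component)
next
  case (Suc k)
  have "(\<lambda>y. \<chi> i. ZP (Suc k) y $ i - z $ i) \<in> path_space \<rightarrow>\<^sub>M count_space UNIV" for z
    by (rule measurable_compose[OF measurable_ZP]) simp
  then have "(\<lambda>y. \<chi> i. ZP (Suc k) y $ i - ZP k (path_shift y) $ i) \<in> path_space \<rightarrow>\<^sub>M count_space UNIV"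
    by (rule measurable_compose_countable[OF _ measurable_compose[OF measurable_path_shift measurable_ZP]])
  then show ?thesis by (simp only: Suc family.simps(2)[abs_def])
qed

lemma measurable_younger: "younger n \<in> path_space \<rightarrow>\<^sub>M count_space UNIV"
proof (cases n)
  case (Suc k)
  have "(\<lambda>y. ZP k (path_shift y) + z) \<in> path_space \<rightarrow>\<^sub>M count_space UNIV" for z
    by (rule measurable_compose[OF measurable_path_shift], rule measurable_compose[OF measurable_ZP]) simp
  then have "(\<lambda>y. ZP k (path_shift y) + y (Suc k, None)) \<in> path_space \<rightarrow>\<^sub>M count_space UNIV"
    by (rule measurable_compose_countable[OF _ measurable_path_component])
  then show ?thesis by (simp only: Suc younger.simps(2)[abs_def])
qed (simp add: younger.simps(1)[abs_def])

lemma measurable_progeny: "(\<lambda>y. progeny K y i) \<in> path_space \<rightarrow>\<^sub>M count_space UNIV"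
  unfolding progeny_def
  by (intro measurable_sum_count_space measurable_compose[OF measurable_family]) simp

subsection \<open>The ergodic system of environment and inputs\<close>

text \<open>Injectivity makes the singletons \<open>{f j}\<close> disjoint blocks of the original
  index set, and disjoint blocks are independent.\<close>

lemma (in prob_space) indep_vars_reindex:
  assumes ind: "indep_vars M' V I" and f: "inj_on f J" "f ` J \<subseteq> I"
  shows "indep_vars (\<lambda>j. M' (f j)) (\<lambda>j. V (f j)) J"
proof -
  have "indep_vars (\<lambda>j. PiM {f j} M') (\<lambda>j x. restrict (\<lambda>i. V i x) {f j}) J"
    by (rule indep_vars_restrict[OF ind])
       (use f in \<open>auto simp: disjoint_family_on_def inj_on_def\<close>)
  then have "indep_vars (\<lambda>j. M' (f j)) (\<lambda>j x. (\<lambda>g. g (f j)) (restrict (\<lambda>i. V i x) {f j})) J"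
    by (rule indep_vars_compose2) simp
  then show ?thesis by simp
qed

lemma (in prob_space) indep_var_nn_integral:
  fixes U V :: "'a \<Rightarrow> ennreal"
  assumes "indep_var borel U borel V"
  shows "(\<integral>\<^sup>+ x. U x * V x \<partial>M) = (\<integral>\<^sup>+ x. U x \<partial>M) * (\<integral>\<^sup>+ x. V x \<partial>M)"
proof -
  have *: "case_bool borel borel = (\<lambda>_. borel :: ennreal measure)"
    by (auto split: bool.split)
  have "indep_vars (\<lambda>_. borel) (case_bool U V) UNIV"
    using assms unfolding indep_var_def * .
  from indep_vars_nn_integral[OF _ this] show ?thesis
    by (simp add: UNIV_bool mult.commute)
qed

context branching_process_in_environment
begin

section \<open>Quenched law of the inputs\<close>

fun input :: "nat \<times> (nat \<times> 'd) option \<Rightarrow> 'x \<Rightarrow> nat ^ 'd" where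
  "input (n, None) = X n"
| "input (n, Some (m, i)) = L n (Suc m) i"

fun input_law :: "nat \<times> (nat \<times> 'd) option \<Rightarrow> (int \<Rightarrow> 's) \<Rightarrow> (nat ^ 'd) measure" where
  "input_law (n, None) \<omega> = q (\<omega> (int n - 1))"
| "input_law (n, Some (m, i)) \<omega> = p i (\<omega> (int n))"

definition to_path :: "'x \<Rightarrow> 'd path" where
  "to_path x = (\<lambda>j. input j x)"

lemma measurable_input: "input j \<in> N \<rightarrow>\<^sub>M count_space UNIV"
  by (cases j rule: input.cases) (auto intro: X_measurable L_measurable)

lemma measurable_to_path [measurable]: "to_path \<in> N \<rightarrow>\<^sub>M path_space"
  by (rule measurable_to_path_space) (simp add: to_path_def measurable_input)

lemma ZP_to_path: "ZP n (to_path x) = Z X L n x"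
  unfolding ZP_def by (rule Z_cong) (auto simp: to_path_def)

lemma space_P: "space P = {\<omega>. \<forall>n. \<omega> n \<in> space S}"
  using sets_eq_imp_space_eq[OF sets_P] by (auto simp: space_PiM PiE_UNIV_domain)

lemma measurable_shift [measurable]: "shift \<in> P \<rightarrow>\<^sub>M P"
proof -
  have "shift \<in> (\<Pi>\<^sub>M n\<in>(UNIV :: int set). S) \<rightarrow>\<^sub>M (\<Pi>\<^sub>M n\<in>(UNIV :: int set). S)"
    unfolding shift_def by (rule measurable_PiM_single') (auto simp: space_PiM)
  then show ?thesis using measurable_cong_sets[OF sets_P sets_P] by simp
qed

lemma shift_in_space [simp]: "shift \<omega> \<in> space P \<longleftrightarrow> \<omega> \<in> space P" for \<omega>
proof -
  have "(\<forall>n. \<omega> (n + 1) \<in> space S) \<longleftrightarrow> (\<forall>n. \<omega> n \<in> space S)"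
    by (metis diff_add_cancel)
  then show ?thesis by (simp add: space_P shift_def)
qed

lemma
  assumes "\<omega> \<in> space P"
  shows prob_space_Q: "prob_space (Q \<omega>)" and sets_Q [measurable_cong]: "sets (Q \<omega>) = sets N"
proof -
  have "Q \<omega> \<in> space (prob_algebra N)"
    by (rule measurable_space[OF Q_measurable assms])
  then show "prob_space (Q \<omega>)" "sets (Q \<omega>) = sets N"
    by (auto simp: space_prob_algebra)
qed

lemma indep_input:
  assumes "\<omega> \<in> space P"
  shows "prob_space.indep_vars (Q \<omega>) (\<lambda>_. count_space UNIV) input UNIV"
proof -
  interpret Q: prob_space "Q \<omega>" by (rule prob_space_Q[OF assms])
  define e :: "nat \<times> (nat \<times> 'd) option \<Rightarrow> nat + nat \<times> nat \<times> 'd" where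
    "e j = (case j of (n, None) \<Rightarrow> Inl n | (n, Some (m, i)) \<Rightarrow> Inr (n, Suc m, i))" for j
  have "inj e" "range e \<subseteq> UNIV <+> UNIV \<times> {1..} \<times> UNIV"
    by (auto simp: inj_def e_def split: option.splits prod.splits)
  from Q.indep_vars_reindex[OF indep[OF assms] this]
  have "Q.indep_vars (\<lambda>_. count_space UNIV) (\<lambda>j. case_sum X (\<lambda>(n, m, i). L n m i) (e j)) UNIV" .
  also have "(\<lambda>j. case_sum X (\<lambda>(n, m, i). L n m i) (e j)) = input"
  proof
    show "case_sum X (\<lambda>(n, m, i). L n m i) (e j) = input j" for j
      by (cases j rule: input.cases) (simp_all add: e_def)
  qed
  finally show ?thesis .
qed

lemma distr_input: "\<omega> \<in> space P \<Longrightarrow> distr (Q \<omega>) (count_space UNIV) (input j) = input_law j \<omega>"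
  by (cases j rule: input.cases) (simp_all add: law_X law_L)

lemma input_law_shift: "input_law (n, c) (shift \<omega>) = input_law (Suc n, c) \<omega>"
  by (cases "(n, c)" rule: input.cases) (simp_all add: shift_def algebra_simps)

definition path_law :: "(int \<Rightarrow> 's) \<Rightarrow> 'd path measure" where
  "path_law \<omega> = distr (Q \<omega>) path_space to_path"

text \<open>Joint independence turns the law of the path into the product of its marginals, so it is
  determined by the environment.\<close>

lemma path_law_eq_PiM:
  assumes "\<omega> \<in> space P"
  shows "path_law \<omega> = (\<Pi>\<^sub>M j\<in>UNIV. input_law j \<omega>)"
proof -
  interpret Q: prob_space "Q \<omega>" by (rule prob_space_Q[OF assms])
  have "input j \<in> Q \<omega> \<rightarrow>\<^sub>M count_space UNIV" for j
    using measurable_input measurable_cong_sets[OF sets_Q[OF assms] refl] by blast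
  from Q.indep_vars_iff_distr_eq_PiM[of UNIV input, OF UNIV_not_empty this] indep_input[OF assms]
  show ?thesis
    by (simp add: path_law_def to_path_def[abs_def] distr_input[OF assms] restrict_UNIV)
qed

lemma measurable_path_law [measurable]: "path_law \<in> P \<rightarrow>\<^sub>M prob_algebra path_space"
  unfolding path_law_def
  using Q_measurable by measurable

lemma
  assumes "\<omega> \<in> space P"
  shows prob_space_path_law: "prob_space (path_law \<omega>)"
    and sets_path_law [measurable_cong]: "sets (path_law \<omega>) = sets path_space"
  using measurable_space[OF measurable_path_law assms] by (auto simp: space_prob_algebra)

text \<open>Dropping the coordinates of time 0 from a product measure leaves the product of the
  remaining marginals, and by \<open>input_law_shift\<close> these are the marginals for
  \<open>shift \<omega>\<close>.\<close>

lemma distr_path_shift: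
  assumes "\<omega> \<in> space P"
  shows "distr (path_law \<omega>) path_space path_shift = path_law (shift \<omega>)"
proof -
  have law: "prob_space (input_law j \<omega>)" "sets (input_law j \<omega>) = UNIV" for j
  proof -
    interpret Q: prob_space "Q \<omega>" by (rule prob_space_Q[OF assms])
    have "input j \<in> Q \<omega> \<rightarrow>\<^sub>M count_space UNIV"
      using measurable_input measurable_cong_sets[OF sets_Q[OF assms] refl] by blast
    from Q.prob_space_distr[OF this] show "prob_space (input_law j \<omega>)"
      by (simp add: distr_input[OF assms])
    show "sets (input_law j \<omega>) = UNIV"
      by (simp add: distr_input[OF assms, symmetric])
  qed
  have "distr (\<Pi>\<^sub>M j\<in>UNIV. input_law j \<omega>) (\<Pi>\<^sub>M j\<in>UNIV. input_law (Suc (fst j), snd j) \<omega>)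
      (\<lambda>y. \<lambda>j\<in>UNIV. y (Suc (fst j), snd j)) = (\<Pi>\<^sub>M j\<in>UNIV. input_law (Suc (fst j), snd j) \<omega>)"
    by (rule distr_PiM_reindex) (auto simp: law inj_on_def)
  moreover have "sets (\<Pi>\<^sub>M j\<in>UNIV. input_law (Suc (fst j), snd j) \<omega>) = sets path_space"
    by (rule sets_PiM_cong) (simp_all add: law)
  moreover have "(\<Pi>\<^sub>M j\<in>UNIV. input_law (Suc (fst j), snd j) \<omega>) = path_law (shift \<omega>)"
    using assms by (subst path_law_eq_PiM) (auto simp: input_law_shift intro!: PiM_cong)
  ultimately show ?thesis
    using path_law_eq_PiM[OF assms]
    by (simp add: path_shift_def[abs_def] restrict_UNIV cong: distr_cong)
qed

section \<open>The joint system of environment and path: invariance and ergodicity\<close>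

definition path_system :: "((int \<Rightarrow> 's) \<times> 'd path) measure" where
  "path_system = distr (annealed P N Q) (P \<Otimes>\<^sub>M path_space) (\<lambda>(\<omega>, x). (\<omega>, to_path x))"

definition system_shift :: "(int \<Rightarrow> 's) \<times> 'd path \<Rightarrow> (int \<Rightarrow> 's) \<times> 'd path" where
  "system_shift = (\<lambda>(\<omega>, y). (shift \<omega>, path_shift y))"

lemma system_shift_funpow:
  "(system_shift ^^ k) (\<omega>, y) = ((shift ^^ k) \<omega>, (path_shift ^^ k) y)"
  by (induction k) (simp_all add: system_shift_def)

lemma annealed_kernel:
  "(\<lambda>\<omega>. distr (Q \<omega>) (P \<Otimes>\<^sub>M N) (Pair \<omega>)) \<in> P \<rightarrow>\<^sub>M prob_algebra (P \<Otimes>\<^sub>M N)"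
  using Q_measurable by measurable

lemma P_in_prob_algebra: "P \<in> space (prob_algebra P)"
  using prob_space_axioms by (simp add: space_prob_algebra)

lemma sets_annealed [measurable_cong]: "sets (annealed P N Q) = sets (P \<Otimes>\<^sub>M N)"
  unfolding annealed_def by (rule sets_bind'[OF P_in_prob_algebra annealed_kernel])

lemma prob_space_annealed: "prob_space (annealed P N Q)"
  unfolding annealed_def by (rule prob_space_bind'[OF P_in_prob_algebra annealed_kernel])

lemma nn_integral_annealed:
  assumes [measurable]: "f \<in> borel_measurable (P \<Otimes>\<^sub>M N)"
  shows "(\<integral>\<^sup>+ z. f z \<partial>annealed P N Q) = (\<integral>\<^sup>+ \<omega>. \<integral>\<^sup>+ x. f (\<omega>, x) \<partial>Q \<omega> \<partial>P)"
proof -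
  have "(\<integral>\<^sup>+ z. f z \<partial>annealed P N Q) =
      (\<integral>\<^sup>+ \<omega>. \<integral>\<^sup>+ z. f z \<partial>distr (Q \<omega>) (P \<Otimes>\<^sub>M N) (Pair \<omega>) \<partial>P)"
    unfolding annealed_def
    by (rule nn_integral_bind[OF assms measurable_prob_algebraD[OF annealed_kernel]])
  also have "\<dots> = (\<integral>\<^sup>+ \<omega>. \<integral>\<^sup>+ x. f (\<omega>, x) \<partial>Q \<omega> \<partial>P)"
  proof (rule nn_integral_cong)
    fix \<omega> assume \<omega>: "\<omega> \<in> space P"
    have "Pair \<omega> \<in> Q \<omega> \<rightarrow>\<^sub>M P \<Otimes>\<^sub>M N"
      using measurable_Pair1'[OF \<omega>] measurable_cong_sets[OF sets_Q[OF \<omega>] refl] by blast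
    then show "(\<integral>\<^sup>+ z. f z \<partial>distr (Q \<omega>) (P \<Otimes>\<^sub>M N) (Pair \<omega>)) = (\<integral>\<^sup>+ x. f (\<omega>, x) \<partial>Q \<omega>)"
      by (rule nn_integral_distr) simp
  qed
  finally show ?thesis .
qed

lemma measurable_map_to_path: "(\<lambda>(\<omega>, x). (\<omega>, to_path x)) \<in> annealed P N Q \<rightarrow>\<^sub>M P \<Otimes>\<^sub>M path_space"
  by measurable

lemma sets_path_system [measurable_cong]: "sets path_system = sets (P \<Otimes>\<^sub>M path_space)"
  by (simp add: path_system_def)

lemma space_path_system: "space path_system = space P \<times> UNIV"
  by (simp add: path_system_def space_pair_measure)

lemma nn_integral_path_system_Q:
  assumes f [measurable]: "f \<in> borel_measurable (P \<Otimes>\<^sub>M path_space)"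
  shows "(\<integral>\<^sup>+ z. f z \<partial>path_system) = (\<integral>\<^sup>+ \<omega>. \<integral>\<^sup>+ x. f (\<omega>, to_path x) \<partial>Q \<omega> \<partial>P)"
proof -
  have "(\<integral>\<^sup>+ z. f z \<partial>path_system) = (\<integral>\<^sup>+ z. f ((\<lambda>(\<omega>, x). (\<omega>, to_path x)) z) \<partial>annealed P N Q)"
    unfolding path_system_def by (rule nn_integral_distr[OF measurable_map_to_path]) simp
  also have "\<dots> = (\<integral>\<^sup>+ \<omega>. \<integral>\<^sup>+ x. f (\<omega>, to_path x) \<partial>Q \<omega> \<partial>P)"
    by (subst nn_integral_annealed) (simp_all add: split_beta)
  finally show ?thesis .
qed

lemma nn_integral_path_system:
  assumes f [measurable]: "f \<in> borel_measurable (P \<Otimes>\<^sub>M path_space)"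
  shows "(\<integral>\<^sup>+ z. f z \<partial>path_system) = (\<integral>\<^sup>+ \<omega>. \<integral>\<^sup>+ y. f (\<omega>, y) \<partial>path_law \<omega> \<partial>P)"
  unfolding nn_integral_path_system_Q[OF f]
proof (rule nn_integral_cong)
  fix \<omega> assume \<omega>: "\<omega> \<in> space P"
  have "to_path \<in> Q \<omega> \<rightarrow>\<^sub>M path_space"
    using measurable_to_path measurable_cong_sets[OF sets_Q[OF \<omega>] refl] by blast
  moreover have "(\<lambda>y. f (\<omega>, y)) \<in> borel_measurable path_space"
    using \<omega> by measurable
  ultimately show "(\<integral>\<^sup>+ x. f (\<omega>, to_path x) \<partial>Q \<omega>) = (\<integral>\<^sup>+ y. f (\<omega>, y) \<partial>path_law \<omega>)"
    unfolding path_law_def by (simp add: nn_integral_distr)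
qed

lemma measurable_system_shift [measurable]: "system_shift \<in> path_system \<rightarrow>\<^sub>M path_system"
  unfolding system_shift_def by measurable

lemma borel_measurable_path_integral:
  assumes [measurable]: "f \<in> borel_measurable (P \<Otimes>\<^sub>M path_space)"
  shows "(\<lambda>\<omega>. \<integral>\<^sup>+ y. f (\<omega>, y) \<partial>path_law \<omega>) \<in> borel_measurable P"
  by (rule nn_integral_measurable_subprob_algebra2[where N = path_space])
     (simp_all add: measurable_prob_algebraD[OF measurable_path_law])

lemma path_integral_shift:
  assumes f [measurable]: "f \<in> borel_measurable (P \<Otimes>\<^sub>M path_space)" and \<omega>: "\<omega> \<in> space P"
  shows "(\<integral>\<^sup>+ y. f (shift \<omega>, path_shift y) \<partial>path_law \<omega>) = (\<integral>\<^sup>+ y. f (shift \<omega>, y) \<partial>path_law (shift \<omega>))"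
proof -
  have "path_shift \<in> path_law \<omega> \<rightarrow>\<^sub>M path_space"
    using measurable_path_shift measurable_cong_sets[OF sets_path_law[OF \<omega>] refl] by blast
  moreover have "(\<lambda>y. f (shift \<omega>, y)) \<in> borel_measurable path_space"
    using \<omega> by measurable
  ultimately show ?thesis
    unfolding distr_path_shift[OF \<omega>, symmetric] by (simp add: nn_integral_distr)
qed

text \<open>Given \<open>\<omega>\<close>, the shifted path has the quenched law of
  \<open>shift \<omega>\<close>, and \<open>shift \<omega>\<close> again has law
  \<open>P\<close>.\<close>

lemma path_system_preserving: "distr path_system path_system system_shift = path_system"
proof (rule measure_eqI)
  fix A assume "A \<in> sets (distr path_system path_system system_shift)"
  then have A [measurable]: "A \<in> sets (P \<Otimes>\<^sub>M path_space)" by (simp add: sets_path_system)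
  define f :: "(int \<Rightarrow> 's) \<times> 'd path \<Rightarrow> ennreal" where "f = indicator A"
  have [measurable]: "f \<in> borel_measurable (P \<Otimes>\<^sub>M path_space)" by (simp add: f_def)
  note [measurable] = borel_measurable_path_integral
  have [measurable]: "system_shift \<in> P \<Otimes>\<^sub>M path_space \<rightarrow>\<^sub>M P \<Otimes>\<^sub>M path_space"
    unfolding system_shift_def by measurable
  have "emeasure (distr path_system path_system system_shift) A =
      (\<integral>\<^sup>+ z. f z \<partial>distr path_system path_system system_shift)"
    unfolding f_def by (subst nn_integral_indicator) (simp_all add: sets_path_system)
  also have "\<dots> = (\<integral>\<^sup>+ z. f (system_shift z) \<partial>path_system)"
    by (rule nn_integral_distr) simp_all
  also have "\<dots> = (\<integral>\<^sup>+ \<omega>. \<integral>\<^sup>+ y. f (system_shift (\<omega>, y)) \<partial>path_law \<omega> \<partial>P)"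
    by (rule nn_integral_path_system) simp
  also have "\<dots> = (\<integral>\<^sup>+ \<omega>. \<integral>\<^sup>+ y. f (shift \<omega>, y) \<partial>path_law (shift \<omega>) \<partial>P)"
    by (intro nn_integral_cong) (simp add: system_shift_def path_integral_shift)
  also have "\<dots> = (\<integral>\<^sup>+ \<omega>. \<integral>\<^sup>+ y. f (\<omega>, y) \<partial>path_law \<omega> \<partial>distr P P shift)"
    by (rule nn_integral_distr[symmetric]) simp_all
  also have "\<dots> = (\<integral>\<^sup>+ z. f z \<partial>path_system)"
    unfolding stationary by (simp add: nn_integral_path_system)
  also have "\<dots> = emeasure path_system A"
    unfolding f_def by (subst nn_integral_indicator) (simp_all add: sets_path_system)
  finally show "emeasure (distr path_system path_system system_shift) A = emeasure path_system A" .
qed simp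

text \<open>The section of \<open>A\<close> at \<open>\<omega>\<close> need not be shift invariant
  itself. It equals the preimage under \<open>n\<close> path shifts of the section at
  \<open>(shift ^^ n) \<omega>\<close>, which is a fixed set once \<open>\<omega>\<close> is given.
  Hence it depends only on generations from \<open>n\<close> on, for every \<open>n\<close>, and
  Kolmogorov's law applies.\<close>

lemma quenched_0_1:
  assumes A [measurable]: "A \<in> sets (P \<Otimes>\<^sub>M path_space)"
    and inv: "\<And>\<omega> y. \<omega> \<in> space P \<Longrightarrow> (shift \<omega>, path_shift y) \<in> A \<longleftrightarrow> (\<omega>, y) \<in> A"
    and \<omega>: "\<omega> \<in> space P"
  shows "measure (path_law \<omega>) (Pair \<omega> -` A) = 0 \<or> measure (path_law \<omega>) (Pair \<omega> -` A) = 1"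
proof -
  interpret Q: prob_space "Q \<omega>" by (rule prob_space_Q[OF \<omega>])
  \<comment> \<open>Grouping the inputs by generation gives a sequence of independent variables, as
    needed for tail events.\<close>
  define block where "block n x = restrict (\<lambda>j. input j x) ({n} \<times> UNIV)" for n x
  define B where "B n = (\<Pi>\<^sub>M j\<in>{n} \<times> (UNIV :: (nat \<times> 'd) option set). count_space (UNIV :: (nat ^ 'd) set))"
    for n :: nat
  define F where "F n = {block n -` C \<inter> space (Q \<omega>) | C. C \<in> sets (B n)}" for n
  have "Q.indep_vars B block UNIV"
    unfolding B_def block_def
    by (rule Q.indep_vars_restrict[OF indep_input[OF \<omega>]]) (auto simp: disjoint_family_on_def)
  then have indep_F: "Q.indep_sets F UNIV" and block: "\<And>n. block n \<in> Q \<omega> \<rightarrow>\<^sub>M B n"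
    unfolding Q.indep_vars_def2 F_def by auto
  have F_eq: "F n = sets (vimage_algebra (space (Q \<omega>)) (block n) (B n))" for n
    unfolding F_def by (rule sets_vimage_algebra2[symmetric]) (use measurable_space[OF block] in auto)
  have sa: "sigma_algebra (space (Q \<omega>)) (F n)" for n
    unfolding F_eq using sets.sigma_algebra_axioms[of "vimage_algebra (space (Q \<omega>)) (block n) (B n)"]
    by simp
  define D where "D = to_path -` (Pair \<omega> -` A) \<inter> space (Q \<omega>)"
  have to_path: "to_path \<in> Q \<omega> \<rightarrow>\<^sub>M path_space"
    using measurable_to_path measurable_cong_sets[OF sets_Q[OF \<omega>] refl] by blast
  have inv_funpow: "((shift ^^ n) \<omega>', (path_shift ^^ n) y) \<in> A \<longleftrightarrow> (\<omega>', y) \<in> A"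
    if "\<omega>' \<in> space P" for n \<omega>' y
    using that
  proof (induction n arbitrary: \<omega>' y)
    case (Suc n)
    then show ?case using inv[of \<omega>' y] Suc.IH[of "shift \<omega>'" "path_shift y"]
      by (simp add: funpow_swap1)
  qed simp
  have shift_funpow: "(shift ^^ n) \<omega> \<in> space P" for n
    by (induction n) (simp_all add: \<omega>)
  have "D \<in> Q.tail_events F"
    unfolding Q.tail_events_def
  proof
    fix n
    define G where "G = sigma (space (Q \<omega>)) (\<Union> (F ` {n..}))"
    have sub: "\<Union> (F ` {n..}) \<subseteq> Pow (space (Q \<omega>))"
      by (auto simp: F_def)
    have space_G: "space G = space (Q \<omega>)" and sets_G: "sets G = sigma_sets (space (Q \<omega>)) (\<Union> (F ` {n..}))"
      unfolding G_def using sub by (simp_all add: space_measure_of sets_measure_of)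
    have input: "input (n + k, c) \<in> G \<rightarrow>\<^sub>M count_space UNIV" for k c
    proof (rule measurableI)
      fix C :: "(nat ^ 'd) set"
      have "input (n + k, c) -` C \<inter> space G =
          block (n + k) -` {f \<in> space (B (n + k)). f (n + k, c) \<in> C} \<inter> space (Q \<omega>)"
        using measurable_space[OF block] by (auto simp: space_G block_def)
      moreover have "{f \<in> space (B (n + k)). f (n + k, c) \<in> C} \<in> sets (B (n + k))"
        unfolding B_def by (rule sets_Collect_single) auto
      ultimately have "input (n + k, c) -` C \<inter> space G \<in> F (n + k)"
        unfolding F_def by blast
      then show "input (n + k, c) -` C \<inter> space G \<in> sets G"
        unfolding sets_G by (intro sigma_sets.Basic) auto
    qed simp
    have "(\<lambda>x. (path_shift ^^ n) (to_path x)) \<in> G \<rightarrow>\<^sub>M path_space"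
    proof (rule measurable_to_path_space)
      fix j :: "nat \<times> (nat \<times> 'd) option"
      show "(\<lambda>x. (path_shift ^^ n) (to_path x) j) \<in> G \<rightarrow>\<^sub>M count_space UNIV"
        using input[of "fst j" "snd j"] by (cases j) (simp add: to_path_def)
    qed
    moreover have "Pair ((shift ^^ n) \<omega>) -` A \<in> sets path_space"
      by (rule sets_Pair1[OF A])
    ultimately have "(\<lambda>x. (path_shift ^^ n) (to_path x)) -` (Pair ((shift ^^ n) \<omega>) -` A) \<inter> space G \<in> sets G"
      by (rule measurable_sets)
    \<comment> \<open>By invariance, membership in \<open>A\<close> may be tested after
      \<open>n\<close> joint shifts.\<close>
    also have "(\<lambda>x. (path_shift ^^ n) (to_path x)) -` (Pair ((shift ^^ n) \<omega>) -` A) \<inter> space G = D"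
      using inv_funpow[OF \<omega>] by (auto simp: D_def space_G)
    finally show "D \<in> sigma_sets (space (Q \<omega>)) (\<Union> (F ` {n..}))"
      by (simp add: sets_G)
  qed
  from Q.kolmogorov_0_1_law[OF sa indep_F this]
  have "Q.prob D = 0 \<or> Q.prob D = 1" .
  moreover have "measure (path_law \<omega>) (Pair \<omega> -` A) = Q.prob D"
    unfolding path_law_def D_def by (rule measure_distr[OF to_path sets_Pair1[OF A]])
  ultimately show ?thesis by simp
qed

text \<open>The quenched probability \<open>g\<close> of an invariant event takes only the values 0
  and 1 and is unchanged by \<open>shift\<close>. So \<open>{g = 1}\<close> is an invariant event of
  the ergodic environment, and its probability is that of \<open>A\<close>.\<close>

lemma ergodic_path_system: "ergodic_system path_system system_shift"
proof -
  interpret J: prob_space path_system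
    unfolding path_system_def
    by (rule prob_space.prob_space_distr[OF prob_space_annealed measurable_map_to_path])
  show ?thesis
  proof
    show "system_shift \<in> path_system \<rightarrow>\<^sub>M path_system" by simp
    show "distr path_system path_system system_shift = path_system" by (rule path_system_preserving)
    fix A assume A: "A \<in> sets path_system" and inv: "system_shift -` A \<inter> space path_system = A"
    have A' [measurable]: "A \<in> sets (P \<Otimes>\<^sub>M path_space)"
      using A by (simp add: sets_path_system)
    have inv': "(shift \<omega>, path_shift y) \<in> A \<longleftrightarrow> (\<omega>, y) \<in> A" if "\<omega> \<in> space P" for \<omega> y
      using inv that by (auto simp: system_shift_def space_path_system)
    define g where "g \<omega> = (\<integral>\<^sup>+ y. indicator A (\<omega>, y) \<partial>path_law \<omega>)" for \<omega>
    have [measurable]: "g \<in> borel_measurable P"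
      unfolding g_def by (rule borel_measurable_path_integral) simp
    have g_eq: "g \<omega> = emeasure (path_law \<omega>) (Pair \<omega> -` A)" if "\<omega> \<in> space P" for \<omega>
    proof -
      have "g \<omega> = (\<integral>\<^sup>+ y. indicator (Pair \<omega> -` A) y \<partial>path_law \<omega>)"
        unfolding g_def by (intro nn_integral_cong) (simp add: indicator_def)
      also have "\<dots> = emeasure (path_law \<omega>) (Pair \<omega> -` A)"
        by (rule nn_integral_indicator) (simp add: sets_path_law[OF that] sets_Pair1[OF A'])
      finally show ?thesis .
    qed
    have g_0_1: "g \<omega> = 0 \<or> g \<omega> = 1" if "\<omega> \<in> space P" for \<omega>
    proof -
      interpret R: prob_space "path_law \<omega>" by (rule prob_space_path_law[OF that])
      show ?thesis
        using quenched_0_1[OF A' inv' that] by (auto simp: g_eq[OF that] R.emeasure_eq_measure)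
    qed
    have g_shift: "g (shift \<omega>) = g \<omega>" if "\<omega> \<in> space P" for \<omega>
    proof -
      have "g (shift \<omega>) = (\<integral>\<^sup>+ y. indicator A (shift \<omega>, path_shift y) \<partial>path_law \<omega>)"
        unfolding g_def by (rule path_integral_shift[symmetric, OF _ that]) simp
      also have "\<dots> = g \<omega>"
        unfolding g_def by (intro nn_integral_cong) (simp add: indicator_def inv' that)
      finally show ?thesis .
    qed
    define C where "C = {\<omega> \<in> space P. g \<omega> = 1}"
    have C [measurable]: "C \<in> sets P" unfolding C_def by measurable
    have "shift -` C \<inter> space P = C"
      by (auto simp: C_def g_shift)
    then have "prob C = 0 \<or> prob C = 1" by (rule ergodic[OF C])
    moreover have "J.prob A = prob C"
    proof -
      have "emeasure path_system A = (\<integral>\<^sup>+ z. indicator A z \<partial>path_system)"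
        using A by simp
      also have "\<dots> = (\<integral>\<^sup>+ \<omega>. g \<omega> \<partial>P)"
        unfolding g_def by (rule nn_integral_path_system) simp
      also have "\<dots> = (\<integral>\<^sup>+ \<omega>. indicator C \<omega> \<partial>P)"
        by (intro nn_integral_cong) (use g_0_1 in \<open>auto simp: C_def indicator_def\<close>)
      finally show ?thesis by (simp add: measure_def)
    qed
    ultimately show "J.prob A = 0 \<or> J.prob A = 1" by simp
  qed
qed

end

subsection \<open>Mean progeny and the law of large numbers\<close>

lemma ennreal_of_nat_divide: "n > 0 \<Longrightarrow> (of_nat m / of_nat n :: ennreal) = ennreal (real m / real n)"
  by (simp add: ennreal_of_nat_eq_real_of_nat divide_ennreal)

text \<open>Below, the average of \<open>s\<close> at \<open>n + K\<close> dominates the average of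
  \<open>a K\<close> over \<open>n\<close> terms times \<open>n / (n + K)\<close>, a factor tending
  to 1; a suitable \<open>K\<close> brings \<open>r K\<close> above any level under the supremum.
  Above, the comparison is direct.\<close>

lemma tendsto_average_squeeze:
  fixes s :: "nat \<Rightarrow> nat" and a :: "nat \<Rightarrow> nat \<Rightarrow> nat" and r :: "nat \<Rightarrow> ennreal"
  assumes lower: "\<And>K. (\<lambda>n. (\<Sum>k<n. of_nat (a K k)) / of_nat n) \<longlonglongrightarrow> r K"
    and upper: "(\<lambda>n. (\<Sum>k<n. SUP K. of_nat (a K k)) / of_nat n) \<longlonglongrightarrow> (SUP K. r K)"
    and s_upper: "\<And>n. of_nat (s n) \<le> (\<Sum>k<n. SUP K. of_nat (a K k) :: ennreal)"
    and s_lower: "\<And>K n. (\<Sum>k<n. a K k) \<le> s (n + K)"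
  shows "(\<lambda>n. ennreal (real (s n) / real n)) \<longlonglongrightarrow> (SUP K. r K)"
proof (rule order_tendstoI)
  fix c assume "c < (SUP K. r K)"
  then obtain K where K: "c < r K" by (auto simp: less_SUP_iff)
  have "(\<lambda>n. 1 - real K / real (n + K)) \<longlonglongrightarrow> 1 - 0"
    by (intro tendsto_intros LIMSEQ_ignore_initial_segment[OF lim_const_over_n])
  moreover have "\<forall>\<^sub>F n in sequentially. 1 - real K / real (n + K) = real n / real (n + K)"
      using eventually_gt_at_top[of 0] by eventually_elim (simp add: field_simps)
  ultimately have "(\<lambda>n. real n / real (n + K)) \<longlonglongrightarrow> 1 - 0"
    by (rule Lim_transform_eventually)
  then have "(\<lambda>n. ennreal (real n / real (n + K))) \<longlonglongrightarrow> ennreal (1 - 0)"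
    by (rule tendsto_ennrealI)
  then have "(\<lambda>n. (\<Sum>k<n. of_nat (a K k)) / of_nat n * ennreal (real n / real (n + K))) \<longlonglongrightarrow> r K * ennreal (1 - 0)"
    by (intro tendsto_mult_ennreal lower) auto
  then have "\<forall>\<^sub>F n in sequentially. c < (\<Sum>k<n. of_nat (a K k)) / of_nat n * ennreal (real n / real (n + K))"
    by (rule order_tendstoD) (use K in simp)
  then have "\<forall>\<^sub>F n in sequentially. c < ennreal (real (s (n + K)) / real (n + K))"
    using eventually_gt_at_top[of 0]
  proof eventually_elim
    case (elim n)
    have "(\<Sum>k<n. of_nat (a K k)) / of_nat n * ennreal (real n / real (n + K)) =
        ennreal (real (\<Sum>k<n. a K k) / real n) * ennreal (real n / real (n + K))"
      using elim by (simp only: ennreal_of_nat_divide flip: of_nat_sum)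
    also have "\<dots> = ennreal (real (\<Sum>k<n. a K k) / real (n + K))"
      using elim by (subst ennreal_mult[symmetric]) (simp_all add: sum_nonneg)
    also have "\<dots> \<le> ennreal (real (s (n + K)) / real (n + K))"
      by (intro ennreal_leI divide_right_mono of_nat_mono s_lower) simp
    finally show ?case using elim by simp
  qed
  then show "\<forall>\<^sub>F n in sequentially. c < ennreal (real (s n) / real n)"
    by (simp only: eventually_sequentially_seg[of "\<lambda>n. c < ennreal (real (s n) / real n)"])
next
  fix c assume "(SUP K. r K) < c"
  from order_tendstoD(2)[OF upper this] eventually_gt_at_top[of 0]
  show "\<forall>\<^sub>F n in sequentially. ennreal (real (s n) / real n) < c"
  proof eventually_elim
    case (elim n)
    have "ennreal (real (s n) / real n) = of_nat (s n) / of_nat n"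
      using elim by (simp add: ennreal_of_nat_divide)
    also have "\<dots> \<le> (\<Sum>k<n. SUP K. of_nat (a K k)) / of_nat n"
      by (intro divide_right_mono_ennreal s_upper)
    finally show ?case using elim by simp
  qed
qed

context branching_process_in_environment
begin

text \<open>The assumption \<open>h_upd\<close> says that \<open>h\<close> ignores coordinate
  \<open>j\<close>. Since \<open>restrict\<close> puts \<open>undefined\<close> there,
  \<open>h\<close> is a function of the other inputs, which are independent of
  \<open>input j\<close>.\<close>

lemma nn_integral_indep_input:
  fixes h :: "'d path \<Rightarrow> ennreal" and u :: "nat ^ 'd \<Rightarrow> ennreal"
  assumes \<omega>: "\<omega> \<in> space P" and h: "h \<in> borel_measurable path_space"
    and h_upd: "\<And>y. h (y(j := undefined)) = h y"
  shows "(\<integral>\<^sup>+ x. h (to_path x) * u (input j x) \<partial>Q \<omega>) =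
    (\<integral>\<^sup>+ x. h (to_path x) \<partial>Q \<omega>) * (\<integral>\<^sup>+ x. u (input j x) \<partial>Q \<omega>)"
proof -
  interpret Q: prob_space "Q \<omega>" by (rule prob_space_Q[OF \<omega>])
  let ?M = "\<lambda>J. \<Pi>\<^sub>M j\<in>J. count_space (UNIV :: (nat ^ 'd) set)"
  \<comment> \<open>On the product over the other coordinates, the coordinate \<open>j\<close> is
    constantly \<open>undefined\<close>.\<close>
  have id: "(\<lambda>y. y) \<in> ?M (UNIV - {j}) \<rightarrow>\<^sub>M path_space"
  proof (rule measurable_to_path_space)
    fix k
    show "(\<lambda>y. y k) \<in> ?M (UNIV - {j}) \<rightarrow>\<^sub>M count_space UNIV"
    proof (cases "k = j")
      case True
      have "(\<lambda>y. y k) \<in> ?M (UNIV - {j}) \<rightarrow>\<^sub>M count_space UNIV \<longleftrightarrow>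
          (\<lambda>y. undefined) \<in> ?M (UNIV - {j}) \<rightarrow>\<^sub>M count_space (UNIV :: (nat ^ 'd) set)"
        by (rule measurable_cong) (auto simp: True space_PiM PiE_def extensional_def)
      then show ?thesis by simp
    qed (intro measurable_component_singleton, simp)
  qed
  have "Q.indep_var borel (h \<circ> (\<lambda>x. restrict (\<lambda>k. input k x) (UNIV - {j})))
      borel ((\<lambda>y. u (y j)) \<circ> (\<lambda>x. restrict (\<lambda>k. input k x) {j}))"
  proof (rule Q.indep_var_compose)
    show "Q.indep_var (?M (UNIV - {j})) (\<lambda>x. restrict (\<lambda>k. input k x) (UNIV - {j}))
        (?M {j}) (\<lambda>x. restrict (\<lambda>k. input k x) {j})"
      by (rule Q.indep_var_restrict[OF indep_input[OF \<omega>]]) auto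
    show "h \<in> borel_measurable (?M (UNIV - {j}))"
      using measurable_compose[OF id h] .
    show "(\<lambda>y. u (y j)) \<in> borel_measurable (?M {j})"
      by (rule measurable_compose[OF measurable_component_singleton]) auto
  qed
  moreover have "h \<circ> (\<lambda>x. restrict (\<lambda>k. input k x) (UNIV - {j})) = (\<lambda>x. h (to_path x))"
  proof
    fix x
    have "restrict (\<lambda>k. input k x) (UNIV - {j}) = (to_path x)(j := undefined)"
      by (auto simp: to_path_def)
    then show "(h \<circ> (\<lambda>x. restrict (\<lambda>k. input k x) (UNIV - {j}))) x = h (to_path x)"
      by (simp add: h_upd)
  qed
  moreover have "(\<lambda>y. u (y j)) \<circ> (\<lambda>x. restrict (\<lambda>k. input k x) {j}) = (\<lambda>x. u (input j x))"
    by auto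
  ultimately have "Q.indep_var borel (\<lambda>x. h (to_path x)) borel (\<lambda>x. u (input j x))" by simp
  then show ?thesis by (rule Q.indep_var_nn_integral)
qed

lemma nn_integral_offspring:
  assumes \<omega>: "\<omega> \<in> space P"
  shows "(\<integral>\<^sup>+ x. of_nat (input (n, Some (m, i)) x $ j) \<partial>Q \<omega>) = mean_matrix Q L n \<omega> $ j $ i"
proof -
  have *: "(\<integral>\<^sup>+ x. of_nat (L n k i x $ j) \<partial>Q \<omega>) = (\<integral>\<^sup>+ z. of_nat (z $ j) \<partial>p i (\<omega> (int n)))"
    if "k \<ge> 1" for k
  proof -
    have "L n k i \<in> Q \<omega> \<rightarrow>\<^sub>M count_space UNIV"
      using L_measurable[OF that] measurable_cong_sets[OF sets_Q[OF \<omega>] refl] by blast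
    then show ?thesis
      unfolding law_L[OF \<omega> that, symmetric] by (subst nn_integral_distr) simp_all
  qed
  show ?thesis using *[of "Suc m"] *[of 1] by (simp add: mean_matrix_def)
qed

text \<open>A Wald identity for each generation. Whether an index belongs to the family is
  independent of the offspring vector carrying that index, so the mean size is multiplied by the
  mean matrix.\<close>

lemma nn_integral_family:
  assumes \<omega>: "\<omega> \<in> space P"
  shows "(\<integral>\<^sup>+ x. of_nat (family n (to_path x) $ j) \<partial>Q \<omega>) =
    (mean_prod Q L n \<omega> *v imm_mean Q X 0 \<omega>) $ j"
proof (induction n arbitrary: j)
  case 0
  then show ?case by (simp add: imm_mean_def to_path_def)
next
  case (Suc n)
  \<comment> \<open>The indicator that index \<open>m\<close> of type \<open>i\<close> belongs to
    the family; it turns a sum over a random block into a series over all \<open>m\<close>.\<close>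
  define h where "h i m y = (if younger n y $ i \<le> m \<and> m < younger n y $ i + family n y $ i then 1 else 0 :: ennreal)"
    for i m and y :: "'d path"
  have h_meas [measurable]: "h i m \<in> borel_measurable path_space" for i m
  proof -
    have "(\<lambda>y. if a $ i \<le> m \<and> m < a $ i + family n y $ i then 1 else 0 :: ennreal)
        \<in> borel_measurable path_space" for a
      by (rule measurable_compose[OF measurable_family]) simp
    from measurable_compose_countable[OF this measurable_younger]
    show ?thesis unfolding h_def .
  qed
  have h_upd: "h i m (y((n, Some c) := undefined)) = h i m y" for i m c y
  proof -
    have "family n (y((n, Some c) := undefined)) = family n y"
      "younger n (y((n, Some c) := undefined)) = younger n y"
      by (rule family_cong; simp)+
    then show ?thesis by (simp add: h_def)
  qed
  have sum_h: "(\<Sum>m. h i m y * f m) = (\<Sum>m = younger n y $ i..<younger n y $ i + family n y $ i. f m)"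
    for i y and f :: "nat \<Rightarrow> ennreal"
  proof -
    let ?I = "{younger n y $ i..<younger n y $ i + family n y $ i}"
    have "(\<Sum>m. h i m y * f m) = (\<Sum>m\<in>?I. h i m y * f m)"
      by (rule suminf_finite) (auto simp: h_def)
    also have "\<dots> = (\<Sum>m\<in>?I. f m)"
      by (rule sum.cong) (auto simp: h_def)
    finally show ?thesis .
  qed
  have to_path [measurable]: "to_path \<in> Q \<omega> \<rightarrow>\<^sub>M path_space"
    using measurable_to_path measurable_cong_sets[OF sets_Q[OF \<omega>] refl] by blast
  have [measurable]: "(\<lambda>x. input k x) \<in> Q \<omega> \<rightarrow>\<^sub>M count_space UNIV" for k
    using measurable_input measurable_cong_sets[OF sets_Q[OF \<omega>] refl] by blast
  have [measurable]: "(\<lambda>x. of_nat (input k x $ j) :: ennreal) \<in> borel_measurable (Q \<omega>)" for k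
    by (rule measurable_compose[where N = "count_space UNIV" and f = "input k"]) simp_all
  have "(\<integral>\<^sup>+ x. of_nat (family (Suc n) (to_path x) $ j) \<partial>Q \<omega>) =
      (\<integral>\<^sup>+ x. (\<Sum>i\<in>UNIV. \<Sum>m. h i m (to_path x) * of_nat (input (n, Some (m, i)) x $ j)) \<partial>Q \<omega>)"
    by (simp only: sum_h family_Suc_nth of_nat_sum to_path_def)
  also have "\<dots> = (\<Sum>i\<in>UNIV. \<Sum>m. \<integral>\<^sup>+ x. h i m (to_path x) * of_nat (input (n, Some (m, i)) x $ j) \<partial>Q \<omega>)"
    by (simp add: nn_integral_sum nn_integral_suminf del: input.simps)
  also have "\<dots> = (\<Sum>i\<in>UNIV. \<Sum>m. (\<integral>\<^sup>+ x. h i m (to_path x) \<partial>Q \<omega>) * mean_matrix Q L n \<omega> $ j $ i)"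
    using nn_integral_indep_input[where u = "\<lambda>z. of_nat (z $ j)", OF \<omega> h_meas h_upd]
    by (simp only: nn_integral_offspring[OF \<omega>])
  \<comment> \<open>Summing the indicators alone gives back the family size, to which the induction
    hypothesis applies.\<close>
  also have "\<dots> = (\<Sum>i\<in>UNIV. (\<integral>\<^sup>+ x. (\<Sum>m. h i m (to_path x) * 1) \<partial>Q \<omega>) * mean_matrix Q L n \<omega> $ j $ i)"
    by (simp add: nn_integral_suminf)
  also have "\<dots> = (\<Sum>i\<in>UNIV. mean_matrix Q L n \<omega> $ j $ i * (mean_prod Q L n \<omega> *v imm_mean Q X 0 \<omega>) $ i)"
    unfolding sum_h by (simp add: Suc.IH mult.commute)
  also have "\<dots> = (mean_prod Q L (Suc n) \<omega> *v imm_mean Q X 0 \<omega>) $ j"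
    by (simp add: matrix_vector_mul_assoc[symmetric] matrix_vector_mult_def[of "mean_matrix Q L n \<omega>"])
  finally show ?case .
qed

lemma nn_integral_progeny:
  "(\<integral>\<^sup>+ z. of_nat (progeny K (snd z) i) \<partial>path_system) =
    (\<Sum>n<K. \<integral>\<^sup>+ \<omega>. (mean_prod Q L (Suc n) \<omega> *v imm_mean Q X 0 \<omega>) $ i \<partial>P)"
proof -
  have meas: "(\<lambda>z. of_nat (family n (snd z) $ i) :: ennreal) \<in> borel_measurable (P \<Otimes>\<^sub>M path_space)" for n
    by (rule measurable_compose[OF measurable_compose[OF measurable_snd measurable_family]]) simp
  then have "(\<integral>\<^sup>+ z. of_nat (progeny K (snd z) i) \<partial>path_system) =
      (\<Sum>n<K. \<integral>\<^sup>+ z. of_nat (family (Suc n) (snd z) $ i) \<partial>path_system)"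
    by (subst nn_integral_sum[symmetric])
       (simp_all add: progeny_def measurable_cong_sets[OF sets_path_system refl] del: family.simps)
  also have "\<dots> = (\<Sum>n<K. \<integral>\<^sup>+ \<omega>. (mean_prod Q L (Suc n) \<omega> *v imm_mean Q X 0 \<omega>) $ i \<partial>P)"
  proof (rule sum.cong[OF refl])
    fix n
    show "(\<integral>\<^sup>+ z. of_nat (family (Suc n) (snd z) $ i) \<partial>path_system) =
        (\<integral>\<^sup>+ \<omega>. (mean_prod Q L (Suc n) \<omega> *v imm_mean Q X 0 \<omega>) $ i \<partial>P)"
      unfolding nn_integral_path_system_Q[OF meas] snd_conv
      by (rule nn_integral_cong) (rule nn_integral_family)
  qed
  finally show ?thesis .
qed

text \<open>Birkhoff's theorem is applied to the progeny after \<open>K\<close> generations, for all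
  \<open>K\<close> at once, and to the total progeny. The squeeze then holds along almost every path
  and is pulled back to the annealed law.\<close>

theorem AE_average_converges:
  "AE (\<omega>, x) in annealed P N Q. \<forall>i. (\<lambda>n. ennreal (real ((\<Sum>k<n. Z X L k x) $ i) / real n)) \<longlonglongrightarrow>
    (\<Sum>n. \<integral>\<^sup>+ \<omega>. (mean_prod Q L (Suc n) \<omega> *v imm_mean Q X 0 \<omega>) $ i \<partial>P)"
proof -
  interpret J: ergodic_system path_system system_shift by (rule ergodic_path_system)
  define f where "f K i z = (of_nat (progeny K (snd z) i) :: ennreal)"
    for K i and z :: "(int \<Rightarrow> 's) \<times> 'd path"
  define r where "r K i = (\<Sum>n<K. \<integral>\<^sup>+ \<omega>. (mean_prod Q L (Suc n) \<omega> *v imm_mean Q X 0 \<omega>) $ i \<partial>P)" for K i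
  have [measurable]: "f K i \<in> borel_measurable path_system" for K i
    unfolding f_def measurable_cong_sets[OF sets_path_system refl]
    by (rule measurable_compose[OF measurable_compose[OF measurable_snd measurable_progeny]]) simp
  have r: "(\<integral>\<^sup>+ z. f K i z \<partial>path_system) = r K i" for K i
    unfolding f_def r_def by (rule nn_integral_progeny)
  have f_mono: "incseq (\<lambda>K. f K i)" for i
    by (auto simp: incseq_def le_fun_def f_def progeny_mono)
  \<comment> \<open>By monotone convergence the mean total progeny is the supremum of the partial
    sums of the series for the limit.\<close>
  have r_sup: "(\<integral>\<^sup>+ z. (SUP K. f K i z) \<partial>path_system) = (SUP K. r K i)" for i
    unfolding r[symmetric]
    by (rule nn_integral_monotone_convergence_SUP[OF f_mono]) simp
  have "AE z in path_system. \<forall>i K. (\<lambda>n. (\<Sum>k<n. f K i ((system_shift ^^ k) z)) / of_nat n) \<longlonglongrightarrow> r K i"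
    unfolding AE_all_countable r[symmetric]
    by (intro allI J.birkhoff_ennreal) simp
  moreover have "AE z in path_system. \<forall>i.
      (\<lambda>n. (\<Sum>k<n. SUP K. f K i ((system_shift ^^ k) z)) / of_nat n) \<longlonglongrightarrow> (SUP K. r K i)"
    unfolding AE_all_countable r_sup[symmetric]
    by (intro allI J.birkhoff_ennreal) simp
  ultimately have "AE z in path_system. \<forall>i.
      (\<lambda>n. ennreal (real (\<Sum>k<n. ZP k (snd z) $ i) / real n)) \<longlonglongrightarrow> (SUP K. r K i)"
  proof eventually_elim
    case (elim z)
    obtain \<omega> y where z: "z = (\<omega>, y)" by (cases z)
    show ?case
      using elim unfolding z f_def system_shift_funpow snd_conv
      by (intro allI tendsto_average_squeeze[where a = "\<lambda>K k. progeny K ((path_shift ^^ k) y) _"])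
         (blast intro: sum_ZP_le sum_ZP_ge)+
  qed
  then have "AE z in annealed P N Q. \<forall>i.
      (\<lambda>n. ennreal (real (\<Sum>k<n. ZP k (snd ((\<lambda>(\<omega>, x). (\<omega>, to_path x)) z)) $ i) / real n)) \<longlonglongrightarrow> (SUP K. r K i)"
    unfolding path_system_def by (rule AE_distrD[OF measurable_map_to_path])
  then show ?thesis
    by (simp add: split_beta ZP_to_path r_def sum_component suminf_eq_SUP)
qed

lemma measurable_average:
  "(\<lambda>z. ennreal (real ((\<Sum>k<n. Z X L k (snd z)) $ i) / real n)) \<in> borel_measurable (annealed P N Q)"
proof -
  have "(\<lambda>x. \<Sum>k<n. Z X L k x) \<in> N \<rightarrow>\<^sub>M count_space UNIV"
    by (intro measurable_sum_count_space measurable_Z X_measurable L_measurable)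
  from measurable_compose[OF measurable_compose[OF measurable_snd this],
      of "\<lambda>v. ennreal (real (v $ i) / real n)" borel]
  show ?thesis by (simp add: measurable_cong_sets[OF sets_annealed refl])
qed

end

theorem theorem1p2:
  fixes S :: "'s measure"
    and P :: "(int \<Rightarrow> 's) measure"
    and q :: "'s \<Rightarrow> (nat ^ 'd) measure"
    and p :: "'d \<Rightarrow> 's \<Rightarrow> (nat ^ 'd) measure"
    and N :: "'x measure"
    and Q :: "(int \<Rightarrow> 's) \<Rightarrow> 'x measure"
    and X :: "nat \<Rightarrow> 'x \<Rightarrow> nat ^ 'd"
    and L :: "nat \<Rightarrow> nat \<Rightarrow> 'd \<Rightarrow> 'x \<Rightarrow> nat ^ 'd"
  defines "Sn \<equiv> \<lambda>n x. \<Sum>k<n. Z X L k x"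
    and "\<rho> \<equiv> \<chi> i. \<Sum>n. \<integral>\<^sup>+ \<omega>. (mean_prod Q L (Suc n) \<omega> *v imm_mean Q X 0 \<omega>) $ i \<partial>P"
  assumes "branching_process_in_environment S P q p N Q X L"
    and A1: "eexpectation P (\<lambda>\<omega>. elog_plus (enorm1 (imm_mean Q X 0 \<omega>))) < \<infinity>"
    and A2: "eexpectation P (\<lambda>\<omega>. elog_plus (eopnorm1 (mean_matrix Q L 0 \<omega>))) < \<infinity>"
    and A3: "\<exists>\<gamma>::ereal. \<gamma> < 0 \<and>
      (\<lambda>n. eexpectation P (\<lambda>\<omega>. elog (eopnorm1 (mean_prod Q L n \<omega>))) / ereal (real n))
        \<longlonglongrightarrow> \<gamma>"
  shows "\<P>((\<omega>, x) in annealed P N Q.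
    \<forall>i. (\<lambda>n. ennreal (real (Sn n x $ i) / real n)) \<longlonglongrightarrow> \<rho> $ i) = 1"
proof -
  interpret branching_process_in_environment S P q p N Q X L by fact
  interpret A: prob_space "annealed P N Q" by (rule prob_space_annealed)
  define F where "F n i z = ennreal (real (Sn n (snd z) $ i) / real n)"
    for n i and z :: "(int \<Rightarrow> 's) \<times> 'x"
  have [measurable]: "F n i \<in> borel_measurable (annealed P N Q)" for n i
    unfolding F_def Sn_def by (rule measurable_average)
  \<comment> \<open>Convergence is restated through \<open>liminf\<close> and \<open>limsup\<close>
    to show that it is an event.\<close>
  have "{z \<in> space (annealed P N Q). \<forall>i. (\<lambda>n. F n i z) \<longlonglongrightarrow> \<rho> $ i} =
      {z \<in> space (annealed P N Q). \<forall>i\<in>UNIV. liminf (\<lambda>n. F n i z) = \<rho> $ i \<and> limsup (\<lambda>n. F n i z) = \<rho> $ i}"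
    by (auto simp: tendsto_iff_Liminf_eq_Limsup)
  also have "\<dots> \<in> sets (annealed P N Q)"
    by measurable
  finally have sets: "{z \<in> space (annealed P N Q). \<forall>i. (\<lambda>n. F n i z) \<longlonglongrightarrow> \<rho> $ i} \<in> sets (annealed P N Q)" .
  have "AE z in annealed P N Q. \<forall>i. (\<lambda>n. F n i z) \<longlonglongrightarrow> \<rho> $ i"
    using AE_average_converges by (simp add: F_def Sn_def \<rho>_def split_beta)
  then have "A.prob {z \<in> space (annealed P N Q). \<forall>i. (\<lambda>n. F n i z) \<longlonglongrightarrow> \<rho> $ i} = 1"
    by (subst A.prob_Collect_eq_1[OF sets])
  then show ?thesis by (simp add: F_def case_prod_unfold)
qed

end
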